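(* Let $\mathbb{A}\in\mathbb{M}_{d,d'}$ be partitioned into four blocks $A,B,C,D$. Then there exist isometries $U,V,W,X$ of suitable sizes such that $$2|\mathbb{A}|\ \ge\ U|A|U^*+V|B|V^*+W|C|W^*+X|D|X^*.$$
   Context: $\mathbb{M}_{n,m}$ is the space of complex $n\times m$ matrices. For $S\in\mathbb{M}_{n,m}$, $|S|=(S^*S)^{1/2}\in\mathbb{M}_m$ is its absolute value. A matrix $U\in\mathbb{M}_{n,m}$ with $m\le n$ is an isometry if $U^*U$ is the identity of $\mathbb{M}_m$; "suitable sizes" means that the isometry attached to a block with $m$ columns belongs to $\mathbb{M}_{d',m}$. The relation $\ge$ between Hermitian matrices is the Loewner order ($X\ge Y$ iff $X-Y$ is positive semidefinite). A partitioning of $\mathbb{A}$ into blocks is any decomposition of the rectangular array of entries of $\mathbb{A}$ into pairwise disjoint nonempty rectangular blocks (submatrices formed by consecutive rows and consecutive columns) covering all entries; the blocks need not come from a grid. *)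

theory Defs
  imports
    "Jordan_Normal_Form.Schur_Decomposition"
    "Jordan_Normal_Form.DL_Submatrix"
begin

text \<open>The library's instance of \<open>\<le>\<close> for matrices is the entrywise order, so the Loewner
  order is defined separately. The adjoint is \<open>mat_adjoint\<close>, and \<open>(P *\<^sub>v v) \<bullet>c v\<close> is
  \<open>v\<^sup>* P v\<close>.\<close>

definition hermitian_mat :: "complex mat \<Rightarrow> bool" where
  "hermitian_mat P \<longleftrightarrow> mat_adjoint P = P"

definition psd_mat :: "complex mat \<Rightarrow> bool" where
  "psd_mat P \<longleftrightarrow>
     hermitian_mat P \<and> (\<forall>v \<in> carrier_vec (dim_row P). 0 \<le> Re ((P *\<^sub>v v) \<bullet>c v))"

definition loewner_ge :: "complex mat \<Rightarrow> complex mat \<Rightarrow> bool" where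
  "loewner_ge X Y \<longleftrightarrow>
     hermitian_mat X \<and> hermitian_mat Y \<and> dim_row X = dim_row Y \<and> psd_mat (X - Y)"

text \<open>A positive semidefinite matrix has exactly one positive semidefinite square root; the
  equation \<open>P * P = A\<close> also forces \<open>P\<close> to have the size of \<open>A\<close>.\<close>

definition psd_sqrt :: "complex mat \<Rightarrow> complex mat" where
  "psd_sqrt A = (THE P. psd_mat P \<and> P * P = A)"

definition mat_abs :: "complex mat \<Rightarrow> complex mat" where
  "mat_abs S = psd_sqrt (mat_adjoint S * S)"

definition mat_isometry :: "complex mat \<Rightarrow> bool" where
  "mat_isometry U \<longleftrightarrow>
     dim_col U \<le> dim_row U \<and> mat_adjoint U * U = 1\<^sub>m (dim_col U)"

text \<open>Block number \<open>k\<close> consists of the rows \<open>r k, \<dots>, r' k - 1\<close> and the columns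
  \<open>c k, \<dots>, c' k - 1\<close> of \<open>M\<close>, counted from \<open>0\<close>. The blocks need not come from a grid.\<close>

definition partitioned_into :: "'a mat \<Rightarrow> 'a mat list \<Rightarrow> bool" where
  "partitioned_into M Bs \<longleftrightarrow>
     (\<exists>r r' c c' :: nat \<Rightarrow> nat.
        (\<forall>k < length Bs. r k < r' k \<and> c k < c' k \<and>
           Bs ! k = submatrix M {r k..<r' k} {c k..<c' k}) \<and>
        (\<forall>k < length Bs. \<forall>l < length Bs. k \<noteq> l \<longrightarrow>
           ({r k..<r' k} \<times> {c k..<c' k}) \<inter> ({r l..<r' l} \<times> {c l..<c' l}) = {}) \<and>
        (\<Union>k < length Bs. {r k..<r' k} \<times> {c k..<c' k}) =
           {..<dim_row M} \<times> {..<dim_col M})"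

end

theory Submission
  imports Defs "Jordan_Normal_Form.Spectral_Radius"
begin

text \<open>
  Why the bound holds. Suppose a matrix \<open>B\<close> is cut by one full horizontal or vertical line into
  \<open>B\<^sub>1\<close> and \<open>B\<^sub>2\<close>. Then \<open>|B|\<^sup>2 = Q\<^sub>1\<^sup>2 + Q\<^sub>2\<^sup>2\<close>, where \<open>Q\<^sub>i = V\<^sub>i |B\<^sub>i| V\<^sub>i\<^sup>*\<close> for isometries \<open>V\<^sub>i\<close>.
  For a horizontal line this is \<open>B\<^sup>*B = B\<^sub>1\<^sup>*B\<^sub>1 + B\<^sub>2\<^sup>*B\<^sub>2\<close> with \<open>V\<^sub>i = 1\<close> (\<open>abs_splits_rows\<close>). For a
  vertical line, write the square matrix \<open>|B|\<close> itself as a row \<open>[X Y]\<close> along the same line. Since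
  \<open>|B|\<close> is Hermitian, \<open>|B|\<^sup>2 = |B| |B|\<^sup>* = XX\<^sup>* + YY\<^sup>*\<close>; since \<open>|B|\<^sup>2 = B\<^sup>*B\<close>, the Gram matrix \<open>X\<^sup>*X\<close>
  is \<open>B\<^sub>1\<^sup>*B\<^sub>1 = |B\<^sub>1|\<^sup>2\<close>. As \<open>X\<close> has at least as many rows as columns, it has a polar decomposition
  \<open>X = V\<^sub>1 |B\<^sub>1|\<close> with \<open>V\<^sub>1\<close> an isometry, whence \<open>XX\<^sup>* = Q\<^sub>1\<^sup>2\<close>; similarly for \<open>Y\<close>
  (\<open>abs_splits_columns\<close>).

  If \<open>p\<^sup>2 + q\<^sup>2 = 1\<close>, the Cauchy-Schwarz inequality gives \<open>(p Q\<^sub>1 + q Q\<^sub>2)\<^sup>2 \<le> Q\<^sub>1\<^sup>2 + Q\<^sub>2\<^sup>2 = |B|\<^sup>2\<close>, and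
  operator monotonicity of the square root gives \<open>p Q\<^sub>1 + q Q\<^sub>2 \<le> |B|\<close>
  (\<open>weighted_sum_le_of_squares\<close>). Assume that \<open>B\<^sub>1\<close> and \<open>B\<^sub>2\<close> are already decomposed into \<open>n\<^sub>1\<close> and
  \<open>n\<^sub>2\<close> blocks with the bounds \<open>\<surd>n\<^sub>i |B\<^sub>i| \<ge> \<Sum> U |A| U\<^sup>*\<close>. The weights \<open>p = \<surd>(n\<^sub>1/n)\<close> and
  \<open>q = \<surd>(n\<^sub>2/n)\<close>, \<open>n = n\<^sub>1 + n\<^sub>2\<close>, then yield \<open>\<surd>n |B| \<ge> \<Sum> U |A| U\<^sup>*\<close> over all \<open>n\<close> blocks
  (\<open>abs_dominates_union\<close>). So the constant is \<open>\<surd>n\<close> for every partition that can be produced by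
  successive full cuts.

  A partition of a rectangle into at most four rectangles always arises in this way
  (\<open>tiling_cut\<close>): without a full cut, the four corners lie in four different rectangles, which
  then are all of them, and following the seams between neighbouring corner rectangles along the
  four sides forces two seams to line up. (Five rectangles may form a pinwheel.) For four blocks
  the constant is \<open>\<surd>4 = 2\<close>.

  The linear algebra behind this is developed from orthonormal families: the spectral theorem for
  Hermitian matrices, existence, uniqueness and monotonicity of the positive square root, and the
  polar decomposition of tall matrices. Sums of operators are compared through their quadratic
  forms, so that sums over a set of blocks are sums of real numbers.
\<close>

section \<open>Adjoints and quadratic forms\<close>

lemma adjoint_carrier [simp, intro]:
  "A \<in> carrier_mat m n \<Longrightarrow> mat_adjoint A \<in> carrier_mat n m"
  unfolding mat_adjoint_def by auto

lemma dim_adjoint [simp]: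
  "dim_row (mat_adjoint A) = dim_col A" "dim_col (mat_adjoint A) = dim_row A"
  unfolding mat_adjoint_def by auto

lemma adjoint_index [simp]:
  fixes A :: "complex mat"
  assumes "i < dim_col A" "j < dim_row A"
  shows "mat_adjoint A $$ (i, j) = cnj (A $$ (j, i))"
  using assms unfolding mat_adjoint_def by (simp add: mat_of_rows_index)

lemma adjoint_adjoint [simp]: "mat_adjoint (mat_adjoint A) = (A :: complex mat)"
  by (rule eq_matI) auto

lemma adjoint_one [simp]: "mat_adjoint (1\<^sub>m n) = (1\<^sub>m n :: complex mat)"
  by (rule eq_matI) auto

lemma adjoint_mult:
  fixes A B :: "complex mat"
  assumes "A \<in> carrier_mat m n" "B \<in> carrier_mat n k"
  shows "mat_adjoint (A * B) = mat_adjoint B * mat_adjoint A"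
  using assms
  by (intro eq_matI) (auto simp: scalar_prod_def mult.commute intro!: sum.cong)

lemma adjoint_add:
  fixes A B :: "complex mat"
  assumes "A \<in> carrier_mat m n" "B \<in> carrier_mat m n"
  shows "mat_adjoint (A + B) = mat_adjoint A + mat_adjoint B"
  using assms by (intro eq_matI) auto

lemma adjoint_minus:
  fixes A B :: "complex mat"
  assumes "A \<in> carrier_mat m n" "B \<in> carrier_mat m n"
  shows "mat_adjoint (A - B) = mat_adjoint A - mat_adjoint B"
  using assms by (intro eq_matI) auto

lemma adjoint_smult_real:
  "mat_adjoint (complex_of_real c \<cdot>\<^sub>m A) = complex_of_real c \<cdot>\<^sub>m mat_adjoint A"
  by (rule eq_matI) auto

lemma cscalar_prod_sum:
  fixes v w :: "complex vec"
  shows "w \<in> carrier_vec n \<Longrightarrow> v \<bullet>c w = (\<Sum>i<n. v $ i * cnj (w $ i))"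
  by (auto simp: scalar_prod_def lessThan_atLeast0 intro!: sum.cong)

lemma cscalar_prod_swap:
  fixes v w :: "complex vec"
  shows "v \<in> carrier_vec n \<Longrightarrow> w \<in> carrier_vec n \<Longrightarrow> w \<bullet>c v = cnj (v \<bullet>c w)"
  by (simp add: cscalar_prod_sum mult.commute)

lemma Re_cscalar_prod_self:
  fixes v :: "complex vec"
  shows "v \<in> carrier_vec n \<Longrightarrow> Re (v \<bullet>c v) = (\<Sum>i<n. (cmod (v $ i))\<^sup>2)"
  by (simp add: cscalar_prod_sum cmod_def) (simp add: power2_eq_square)

lemma cscalar_prod_self_real:
  fixes v :: "complex vec"
  shows "v \<bullet>c v = of_real (Re (v \<bullet>c v))"
proof -
  have v: "v \<in> carrier_vec (dim_vec v)" by auto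
  show ?thesis using cscalar_prod_swap[OF v v] by (simp add: complex_eq_iff)
qed

lemma cscalar_prod_adjoint:
  fixes A :: "complex mat"
  assumes A: "A \<in> carrier_mat m n" and x: "x \<in> carrier_vec n" and y: "y \<in> carrier_vec m"
  shows "(A *\<^sub>v x) \<bullet>c y = x \<bullet>c (mat_adjoint A *\<^sub>v y)"
proof -
  have "(A *\<^sub>v x) \<bullet>c y = (\<Sum>i<m. \<Sum>j<n. A $$ (i, j) * x $ j * cnj (y $ i))"
    using assms by (auto simp: cscalar_prod_sum scalar_prod_def lessThan_atLeast0 sum_distrib_right
        intro!: sum.cong)
  also have "\<dots> = (\<Sum>j<n. \<Sum>i<m. A $$ (i, j) * x $ j * cnj (y $ i))"
    by (rule sum.swap)
  also have "\<dots> = x \<bullet>c (mat_adjoint A *\<^sub>v y)"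
    using assms mult_mat_vec_carrier[OF adjoint_carrier[OF A] y]
    by (subst cscalar_prod_sum[of _ n])
      (auto simp: scalar_prod_def lessThan_atLeast0 sum_distrib_left ac_simps intro!: sum.cong)
  finally show ?thesis .
qed

lemma adjoint_mult_index:
  fixes F G :: "complex mat"
  assumes "F \<in> carrier_mat n k" "G \<in> carrier_mat n l" "i < k" "j < l"
  shows "(mat_adjoint F * G) $$ (i, j) = (\<Sum>r<n. G $$ (r, j) * cnj (F $$ (r, i)))"
  using assms by (auto simp: scalar_prod_def lessThan_atLeast0 mult.commute intro!: sum.cong)

text \<open>Only the real part is kept, so that quadratic forms can be compared and summed over blocks
  as real numbers; for Hermitian \<open>P\<close> nothing is lost.\<close>

definition quad_form :: "complex mat \<Rightarrow> complex vec \<Rightarrow> real" where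
  "quad_form P v = Re ((P *\<^sub>v v) \<bullet>c v)"

lemma quad_form_add:
  assumes "P \<in> carrier_mat n n" "Q \<in> carrier_mat n n" "v \<in> carrier_vec n"
  shows "quad_form (P + Q) v = quad_form P v + quad_form Q v"
  using assms unfolding quad_form_def
  by (simp add: add_mult_distrib_mat_vec[of _ n n] add_scalar_prod_distrib[of _ n])

lemma quad_form_minus:
  assumes "P \<in> carrier_mat n n" "Q \<in> carrier_mat n n" "v \<in> carrier_vec n"
  shows "quad_form (P - Q) v = quad_form P v - quad_form Q v"
  using assms unfolding quad_form_def
  by (simp add: minus_mult_distrib_mat_vec[of _ n n] minus_scalar_prod_distrib[of _ n])

lemma smult_mult_mat_vec:
  fixes P :: "complex mat"
  assumes "P \<in> carrier_mat m n" "v \<in> carrier_vec n"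
  shows "(c \<cdot>\<^sub>m P) *\<^sub>v v = c \<cdot>\<^sub>v (P *\<^sub>v v)"
  using assms by (intro eq_vecI) (auto simp: scalar_prod_def sum_distrib_left mult.assoc)

lemma quad_form_smult:
  assumes "P \<in> carrier_mat n n" "v \<in> carrier_vec n"
  shows "quad_form (of_real c \<cdot>\<^sub>m P) v = c * quad_form P v"
  using assms unfolding quad_form_def
  by (simp add: smult_mult_mat_vec[of _ n n] smult_scalar_prod_distrib[of _ n])

lemma quad_form_conj:
  assumes P: "P \<in> carrier_mat m m" and U: "U \<in> carrier_mat n m" and v: "v \<in> carrier_vec n"
  shows "quad_form (U * P * mat_adjoint U) v = quad_form P (mat_adjoint U *\<^sub>v v)"
proof -
  let ?w = "mat_adjoint U *\<^sub>v v"
  have w: "?w \<in> carrier_vec m" using U by (metis adjoint_carrier mult_mat_vec_carrier v)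
  have "(U * P * mat_adjoint U) *\<^sub>v v = U *\<^sub>v (P *\<^sub>v ?w)"
    using assms w by (simp add: assoc_mult_mat_vec[of _ n m _ n] assoc_mult_mat_vec[of _ n m _ m])
  then show ?thesis
    unfolding quad_form_def using cscalar_prod_adjoint[OF U _ v, of "P *\<^sub>v ?w"] P w by simp
qed

lemma psd_matI:
  assumes "P \<in> carrier_mat n n" "mat_adjoint P = P"
    and "\<And>v. v \<in> carrier_vec n \<Longrightarrow> 0 \<le> quad_form P v"
  shows "psd_mat P"
  using assms unfolding psd_mat_def hermitian_mat_def quad_form_def by auto

lemma psd_matD:
  assumes "psd_mat P" "P \<in> carrier_mat n n"
  shows "mat_adjoint P = P" "v \<in> carrier_vec n \<Longrightarrow> 0 \<le> quad_form P v"
  using assms unfolding psd_mat_def hermitian_mat_def quad_form_def by auto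

lemma quad_form_gram:
  assumes P: "P \<in> carrier_mat m n" and v: "v \<in> carrier_vec n"
  shows "quad_form (mat_adjoint P * P) v = Re ((P *\<^sub>v v) \<bullet>c (P *\<^sub>v v))"
proof -
  have Pv: "P *\<^sub>v v \<in> carrier_vec m" using P v by simp
  have "(mat_adjoint P * P) *\<^sub>v v = mat_adjoint P *\<^sub>v (P *\<^sub>v v)"
    using assms by (simp add: assoc_mult_mat_vec[of _ n m _ n])
  then show ?thesis unfolding quad_form_def
    using cscalar_prod_adjoint[OF adjoint_carrier[OF P] Pv v] by simp
qed

section \<open>Orthonormal families\<close>

definition orthonormal_on :: "nat \<Rightarrow> 'i set \<Rightarrow> ('i \<Rightarrow> complex vec) \<Rightarrow> bool" where
  "orthonormal_on n I e \<longleftrightarrow>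
     (\<forall>i\<in>I. e i \<in> carrier_vec n) \<and>
     (\<forall>i\<in>I. \<forall>j\<in>I. e i \<bullet>c e j = (if i = j then 1 else 0))"

lemma exists_unit_multiple:
  fixes u :: "complex vec"
  assumes u: "u \<in> carrier_vec n" "u \<noteq> 0\<^sub>v n"
  shows "\<exists>c. (c \<cdot>\<^sub>v u) \<bullet>c (c \<cdot>\<^sub>v u) = 1"
proof
  define s where "s = Re (u \<bullet>c u)"
  have us: "u \<bullet>c u = of_real s" unfolding s_def by (rule cscalar_prod_self_real)
  have "u \<bullet>c u \<noteq> 0" using conjugate_square_eq_0_vec[OF u(1)] u(2) by simp
  moreover have "0 \<le> s" unfolding s_def Re_cscalar_prod_self[OF u(1)] by (simp add: sum_nonneg)
  ultimately have s: "0 < s" using us by auto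
  define c where "c = complex_of_real (1 / sqrt s)"
  have "c * c * of_real s = 1"
    using s unfolding c_def by (simp flip: of_real_mult add: field_simps)
  then show "(c \<cdot>\<^sub>v u) \<bullet>c (c \<cdot>\<^sub>v u) = 1"
    using u us by (simp add: conjugate_smult_vec c_def)
qed

text \<open>Fewer than \<open>n\<close> vectors, written as rows of an \<open>n \<times> n\<close> matrix with at least one zero row,
  give a singular matrix; a kernel vector is orthogonal to all of them.\<close>

lemma exists_unit_orthogonal:
  fixes e :: "'i \<Rightarrow> complex vec"
  assumes J: "finite J" "card J < n" and e: "\<And>j. j \<in> J \<Longrightarrow> e j \<in> carrier_vec n"
  shows "\<exists>v \<in> carrier_vec n. v \<bullet>c v = 1 \<and> (\<forall>j\<in>J. v \<bullet>c e j = 0)"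
proof -
  define k where "k = card J"
  obtain g where g: "bij_betw g {0..<k} J"
    using ex_bij_betw_nat_finite[OF J(1)] unfolding k_def by blast
  have k: "k < n" using J unfolding k_def by simp
  define f where "f i = (if i < k then conjugate (e (g i)) else 0\<^sub>v n)" for i
  have f: "f i \<in> carrier_vec n" for i
    using g e unfolding f_def bij_betw_def by auto
  define M where "M = mat\<^sub>r n n (\<lambda>i. if i = k then 0\<^sub>v n else f i)"
  have M: "M \<in> carrier_mat n n" unfolding M_def by simp
  have "det M = 0" unfolding M_def by (rule det_row_0[OF k]) (use f in auto)
  then obtain u where u: "u \<in> carrier_vec n" "u \<noteq> 0\<^sub>v n" "M *\<^sub>v u = 0\<^sub>v n"
    using det_0_iff_vec_prod_zero[OF M] by blast
  have orth: "u \<bullet>c e j = 0" if j: "j \<in> J" for j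
  proof -
    obtain i where i: "i < k" "g i = j" using g j unfolding bij_betw_def by auto
    have "row M i = conjugate (e j)"
      using i k e[OF j] unfolding M_def f_def by (intro eq_vecI) auto
    then have "(M *\<^sub>v u) $ i = conjugate (e j) \<bullet> u" using i k M by simp
    moreover have "(M *\<^sub>v u) $ i = 0" using u(3) i k by simp
    ultimately show ?thesis using conjugate_vec_sprod_comm[OF u(1) e[OF j]] by simp
  qed
  obtain c where "(c \<cdot>\<^sub>v u) \<bullet>c (c \<cdot>\<^sub>v u) = 1"
    using exists_unit_multiple[OF u(1,2)] by blast
  moreover have "(c \<cdot>\<^sub>v u) \<bullet>c e j = 0" if "j \<in> J" for j
    using orth[OF that] e[OF that] u(1) by simp
  ultimately show ?thesis using u(1) by (intro bexI[of _ "c \<cdot>\<^sub>v u"]) auto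
qed

text \<open>The part \<open>J\<close> that is kept may be any subset of the index set. The polar decomposition needs
  this, where the prescribed vectors are those with a nonzero eigenvalue, wherever they stand.\<close>

lemma orthonormal_extend:
  assumes "finite I" "card I \<le> n" "J \<subseteq> I" "orthonormal_on n J e"
  shows "\<exists>e'. orthonormal_on n I e' \<and> (\<forall>j\<in>J. e' j = e j)"
proof -
  have "finite (I - J)" using assms by blast
  then show ?thesis using assms
  proof (induction "I - J" arbitrary: I rule: finite_induct)
    case empty
    then show ?case by (intro exI[of _ e]) (auto simp: orthonormal_on_def)
  next
    case (insert x F)
    define K where "K = I - {x}"
    have x: "x \<in> I" "x \<notin> J" and I: "I = insert x K" "x \<notin> K" "finite K" "J \<subseteq> K"
      and F: "F = K - J"
      using insert unfolding K_def by auto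
    have card: "card K < n" using insert.prems I by simp
    obtain e' where e': "orthonormal_on n K e'" "\<forall>j\<in>J. e' j = e j"
      using insert.hyps(3)[OF F I(3) _ I(4) insert.prems(4)] card by auto
    obtain v where v: "v \<in> carrier_vec n" "v \<bullet>c v = 1" "\<forall>j\<in>K. v \<bullet>c e' j = 0"
      using exists_unit_orthogonal[OF I(3) card, of e'] e'(1)
      unfolding orthonormal_on_def by blast
    have "e' j \<bullet>c v = 0" if "j \<in> K" for j
      using cscalar_prod_swap[OF v(1), of "e' j"] e'(1) v(3) that
      unfolding orthonormal_on_def by simp
    then have "orthonormal_on n I (e'(x := v))"
      using e'(1) v I(1,2) unfolding orthonormal_on_def by auto
    moreover have "\<forall>j\<in>J. (e'(x := v)) j = e j" using e'(2) x by auto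
    ultimately show ?case by blast
  qed
qed

definition family_mat :: "nat \<Rightarrow> nat \<Rightarrow> (nat \<Rightarrow> complex vec) \<Rightarrow> complex mat" where
  "family_mat n k e = mat n k (\<lambda>(r, i). e i $ r)"

lemma family_mat_carrier [simp]: "family_mat n k e \<in> carrier_mat n k"
  unfolding family_mat_def by simp

lemma family_mat_index [simp]: "r < n \<Longrightarrow> i < k \<Longrightarrow> family_mat n k e $$ (r, i) = e i $ r"
  unfolding family_mat_def by simp

lemma adjoint_family_mat_mult_vec:
  assumes "\<And>i. i < k \<Longrightarrow> e i \<in> carrier_vec n" "v \<in> carrier_vec n"
  shows "mat_adjoint (family_mat n k e) *\<^sub>v v = vec k (\<lambda>i. v \<bullet>c e i)"
  using assms(2)
  by (intro eq_vecI) (auto simp: carrier_vecD[OF assms(1)] cscalar_prod_sum[OF assms(1)] scalar_prod_def lessThan_atLeast0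
      family_mat_def mult.commute intro!: sum.cong)

lemma family_mat_isometry:
  assumes "orthonormal_on n {..<k} e"
  shows "mat_adjoint (family_mat n k e) * family_mat n k e = 1\<^sub>m k"
proof (rule eq_matI)
  fix i j assume "i < dim_row (1\<^sub>m k)" "j < dim_col (1\<^sub>m k)"
  then have ij: "i < k" "j < k" by auto
  have "(mat_adjoint (family_mat n k e) * family_mat n k e) $$ (i, j) = e j \<bullet>c e i"
    using ij assms
    by (subst adjoint_mult_index[of _ n k]) (auto simp: orthonormal_on_def cscalar_prod_sum[of _ n])
  then show "(mat_adjoint (family_mat n k e) * family_mat n k e) $$ (i, j) = 1\<^sub>m k $$ (i, j)"
    using ij assms unfolding orthonormal_on_def by auto
qed (auto simp: family_mat_def)

lemma family_mat_unitary:
  assumes "orthonormal_on n {..<n} e"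
  shows "family_mat n n e * mat_adjoint (family_mat n n e) = 1\<^sub>m n"
  by (rule mat_mult_left_right_inverse[OF _ _ family_mat_isometry[OF assms]]) auto

section \<open>The spectral theorem for Hermitian matrices\<close>

lemma orthogonal_to_basis:
  assumes e: "orthonormal_on n {..<n} e" and v: "v \<in> carrier_vec n"
    and orth: "\<And>i. i < n \<Longrightarrow> v \<bullet>c e i = 0"
  shows "v = 0\<^sub>v n"
proof -
  let ?Z = "family_mat n n e"
  have "mat_adjoint ?Z *\<^sub>v v = 0\<^sub>v n"
    using e v orth by (subst adjoint_family_mat_mult_vec) (auto simp: orthonormal_on_def)
  then have "?Z *\<^sub>v (mat_adjoint ?Z *\<^sub>v v) = 0\<^sub>v n"
    by (auto intro!: eq_vecI simp: family_mat_def scalar_prod_def)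
  moreover have "?Z *\<^sub>v (mat_adjoint ?Z *\<^sub>v v) = v"
    using v family_mat_unitary[OF e]
    by (subst assoc_mult_mat_vec[symmetric, of _ n n _ n]) auto
  ultimately show ?thesis by simp
qed

text \<open>Eigenvectors are found one at a time. Given \<open>k < n\<close> orthonormal eigenvectors, extend them to
  an orthonormal basis, let the columns of \<open>F\<close> be the new vectors, and take a unit eigenvector \<open>w\<close>
  of the compression \<open>F\<^sup>*AF\<close>. Then \<open>v = Fw\<close> is a new eigenvector: \<open>Av - cv\<close> is orthogonal to the
  columns of \<open>F\<close> by the choice of \<open>w\<close>, and to the old eigenvectors because \<open>A\<close> is Hermitian.\<close>

lemma hermitian_eigenbasis:
  assumes A: "A \<in> carrier_mat n n" and herm: "mat_adjoint A = A" and "k \<le> n"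
  shows "\<exists>e l. orthonormal_on n {..<k} e \<and> (\<forall>i<k. A *\<^sub>v e i = l i \<cdot>\<^sub>v e i)"
  using \<open>k \<le> n\<close>
proof (induction k)
  case 0
  then show ?case by (auto simp: orthonormal_on_def)
next
  case (Suc k)
  then obtain e0 l where e0: "orthonormal_on n {..<k} e0"
    and l0: "\<And>i. i < k \<Longrightarrow> A *\<^sub>v e0 i = l i \<cdot>\<^sub>v e0 i" by auto
  obtain e where e: "orthonormal_on n {..<n} e" and e_e0: "\<forall>j\<in>{..<k}. e j = e0 j"
    using orthonormal_extend[OF _ _ _ e0, of "{..<n}"] Suc.prems by auto
  have l: "A *\<^sub>v e i = l i \<cdot>\<^sub>v e i" if "i < k" for i using l0 e_e0 that by simp
  have ec: "e i \<in> carrier_vec n" if "i < n" for i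
    using e that unfolding orthonormal_on_def by auto
  have ee: "e i \<bullet>c e j = (if i = j then 1 else 0)" if "i < n" "j < n" for i j
    using e that unfolding orthonormal_on_def by auto
  define m where "m = n - k"
  have m: "0 < m" "k + m = n" using Suc.prems unfolding m_def by auto
  define f where "f i = e (k + i)" for i
  have f: "orthonormal_on n {..<m} f"
    using ec ee m unfolding orthonormal_on_def f_def by auto
  have fc: "f i \<in> carrier_vec n" if "i < m" for i using ec m that unfolding f_def by simp
  define F where "F = family_mat n m f"
  have F: "F \<in> carrier_mat n m" unfolding F_def by simp
  have FF: "mat_adjoint F * F = 1\<^sub>m m" unfolding F_def by (rule family_mat_isometry[OF f])
  define B where "B = mat_adjoint F * (A * F)"
  have B: "B \<in> carrier_mat m m" unfolding B_def using A F by auto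
  obtain c where "eigenvalue B c"
    using spectrum_non_empty[OF B] m unfolding spectrum_def by auto
  then obtain w0 where w0: "w0 \<in> carrier_vec m" "w0 \<noteq> 0\<^sub>v m" "B *\<^sub>v w0 = c \<cdot>\<^sub>v w0"
    using B unfolding eigenvalue_def eigenvector_def by auto
  obtain b where b: "(b \<cdot>\<^sub>v w0) \<bullet>c (b \<cdot>\<^sub>v w0) = 1"
    using exists_unit_multiple[OF w0(1,2)] by blast
  define w where "w = b \<cdot>\<^sub>v w0"
  have w: "w \<in> carrier_vec m" "w \<bullet>c w = 1" "B *\<^sub>v w = c \<cdot>\<^sub>v w"
    using w0 b B unfolding w_def
    by (auto simp: mult_mat_vec[of _ m m] smult_smult_assoc mult.commute)
  define v where "v = F *\<^sub>v w"
  have v: "v \<in> carrier_vec n" unfolding v_def using F w by simp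
  have Fv: "mat_adjoint F *\<^sub>v v = w"
    unfolding v_def using F w FF by (subst assoc_mult_mat_vec[symmetric, of _ m n _ m]) auto
  have FAv: "mat_adjoint F *\<^sub>v (A *\<^sub>v v) = c \<cdot>\<^sub>v w"
    unfolding w(3)[symmetric] B_def v_def using A F w
    by (simp add: assoc_mult_mat_vec[of _ m n _ m] assoc_mult_mat_vec[of _ n n _ m])
  have ve: "v \<bullet>c e i = 0" if i: "i < k" for i
  proof -
    have "mat_adjoint F *\<^sub>v e i = vec m (\<lambda>j. e i \<bullet>c f j)"
      unfolding F_def by (rule adjoint_family_mat_mult_vec) (use fc ec i m in auto)
    also have "\<dots> = 0\<^sub>v m" using i m by (intro eq_vecI) (auto simp: f_def ee)
    finally have "mat_adjoint F *\<^sub>v e i = 0\<^sub>v m" .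
    then show ?thesis
      unfolding v_def using cscalar_prod_adjoint[OF F w(1), of "e i"] ec i m w(1) by simp
  qed
  define u where "u = A *\<^sub>v v - c \<cdot>\<^sub>v v"
  have Av: "A *\<^sub>v v \<in> carrier_vec n" using A v by simp
  have u: "u \<in> carrier_vec n" unfolding u_def using Av v by simp
  have uinner: "u \<bullet>c x = (A *\<^sub>v v) \<bullet>c x - c * (v \<bullet>c x)" if "x \<in> carrier_vec n" for x
    unfolding u_def using that Av v by (subst minus_scalar_prod_distrib[of _ n]) auto
  have "u \<bullet>c e i = 0" if i: "i < n" for i
  proof (cases "i < k")
    case True
    have "(A *\<^sub>v v) \<bullet>c e i = v \<bullet>c (l i \<cdot>\<^sub>v e i)"
      using cscalar_prod_adjoint[OF A v ec[OF i]] herm l[OF True] by simp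
    also have "\<dots> = 0" using ve[OF True] v ec[OF i] by (simp add: conjugate_smult_vec)
    finally show ?thesis using uinner[OF ec[OF i]] ve[OF True] by simp
  next
    case False
    then obtain j where j: "i = k + j" "j < m" using i m by (metis add_less_cancel_left le_Suc_ex not_less)
    have coord: "x \<bullet>c e i = (mat_adjoint F *\<^sub>v x) $ j" if "x \<in> carrier_vec n" for x
      unfolding F_def by (subst adjoint_family_mat_mult_vec) (use fc j that in \<open>auto simp: f_def\<close>)
    show ?thesis using uinner[OF ec[OF i]] coord[OF v] coord[OF Av] Fv FAv j w(1) by simp
  qed
  then have "u = 0\<^sub>v n" by (rule orthogonal_to_basis[OF e u])
  then have eig: "A *\<^sub>v v = c \<cdot>\<^sub>v v"
  proof (intro eq_vecI)
    fix i assume "i < dim_vec (c \<cdot>\<^sub>v v)"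
    then have i: "i < n" using v by simp
    have "u $ i = 0" using \<open>u = 0\<^sub>v n\<close> i by simp
    then show "(A *\<^sub>v v) $ i = (c \<cdot>\<^sub>v v) $ i" using i Av v unfolding u_def by simp
  qed (use A v in auto)
  have "v \<bullet>c v = 1"
    using cscalar_prod_adjoint[OF F w(1) v] Fv w(2) unfolding v_def by simp
  moreover have "e i \<bullet>c v = 0" if "i < k" for i
    using cscalar_prod_swap[OF v ec[of i]] ve[OF that] that m by simp
  ultimately have "orthonormal_on n {..<Suc k} (e(k := v))"
    using v ve ec ee m(2) Suc.prems unfolding orthonormal_on_def
    by (auto simp: less_Suc_eq)
  moreover have "\<forall>i<Suc k. A *\<^sub>v (e(k := v)) i = (l(k := c)) i \<cdot>\<^sub>v (e(k := v)) i"
    using l eig by (auto simp: less_Suc_eq)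
  ultimately show ?case by blast
qed

lemma mult_family_mat:
  assumes "A \<in> carrier_mat m n" "\<And>i. i < k \<Longrightarrow> e i \<in> carrier_vec n"
  shows "A * family_mat n k e = family_mat m k (\<lambda>i. A *\<^sub>v e i)"
  using assms by (intro eq_matI) (auto simp: family_mat_def scalar_prod_def carrier_vecD[OF assms(2)])

lemma family_mat_smult:
  assumes "\<And>i. i < k \<Longrightarrow> e i \<in> carrier_vec n"
  shows "family_mat n k (\<lambda>i. c i \<cdot>\<^sub>v e i) = family_mat n k e * mat_diag k c"
  by (subst mat_diag_mult_right[of _ n])
    (auto simp: family_mat_def carrier_vecD[OF assms] intro!: eq_matI)

lemma spectral_decomposition:
  assumes A: "A \<in> carrier_mat n n" and herm: "mat_adjoint A = A"
  obtains e and l :: "nat \<Rightarrow> real"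
  where "orthonormal_on n {..<n} e"
    and "\<And>i. i < n \<Longrightarrow> A *\<^sub>v e i = of_real (l i) \<cdot>\<^sub>v e i"
    and "\<And>i. i < n \<Longrightarrow> quad_form A (e i) = l i"
    and "A = family_mat n n e * mat_diag n (\<lambda>i. of_real (l i)) * mat_adjoint (family_mat n n e)"
proof -
  obtain e c where e: "orthonormal_on n {..<n} e"
    and eig: "\<And>i. i < n \<Longrightarrow> A *\<^sub>v e i = c i \<cdot>\<^sub>v e i"
    using hermitian_eigenbasis[OF A herm order_refl] by blast
  have ec: "e i \<in> carrier_vec n" and ee: "e i \<bullet>c e i = 1" if "i < n" for i
    using e that unfolding orthonormal_on_def by auto
  define l where "l i = Re (c i)" for i
  have cl: "c i = of_real (l i)" if i: "i < n" for i
  proof -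
    have "c i = (A *\<^sub>v e i) \<bullet>c e i" using ec[OF i] ee[OF i] eig[OF i] by simp
    also have "\<dots> = e i \<bullet>c (A *\<^sub>v e i)"
      using cscalar_prod_adjoint[OF A ec[OF i] ec[OF i]] herm by simp
    also have "\<dots> = cnj (c i)" using ec[OF i] ee[OF i] eig[OF i] by (simp add: conjugate_smult_vec)
    finally show ?thesis unfolding l_def by (simp add: complex_eq_iff)
  qed
  let ?Z = "family_mat n n e" and ?D = "mat_diag n (\<lambda>i. complex_of_real (l i))"
  have eig': "A *\<^sub>v e i = of_real (l i) \<cdot>\<^sub>v e i" if "i < n" for i using eig cl that by simp
  have "A * ?Z = family_mat n n (\<lambda>i. of_real (l i) \<cdot>\<^sub>v e i)"
    using mult_family_mat[OF A ec] eig' by (auto simp: family_mat_def intro!: eq_matI)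
  then have AZ: "A * ?Z = ?Z * ?D" using family_mat_smult[OF ec] by simp
  have "A = A * (?Z * mat_adjoint ?Z)" using family_mat_unitary[OF e] A by simp
  also have "\<dots> = A * ?Z * mat_adjoint ?Z"
    using A by (subst assoc_mult_mat[of _ n n _ n _ n]) auto
  finally have "A = ?Z * ?D * mat_adjoint ?Z" unfolding AZ .
  moreover have "quad_form A (e i) = l i" if "i < n" for i
    unfolding quad_form_def using eig'[OF that] ec[OF that] ee[OF that] by simp
  ultimately show ?thesis using e eig' by (intro that[of e l]) auto
qed

section \<open>Positive semidefinite matrices and their square roots\<close>

lemma adjoint_conj:
  fixes P U :: "complex mat"
  assumes "P \<in> carrier_mat m m" "U \<in> carrier_mat n m" "mat_adjoint P = P"
  shows "mat_adjoint (U * P * mat_adjoint U) = U * P * mat_adjoint U"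
proof -
  have "mat_adjoint (U * P * mat_adjoint U) = U * (mat_adjoint (U * P))"
    using assms adjoint_mult[of "U * P" n m "mat_adjoint U" n] by auto
  also have "mat_adjoint (U * P) = P * mat_adjoint U"
    using assms adjoint_mult[of U n m P m] by auto
  finally show ?thesis using assms assoc_mult_mat[of U n m P m "mat_adjoint U" n] by auto
qed

lemma psd_conj:
  assumes P: "P \<in> carrier_mat m m" "psd_mat P" and U: "U \<in> carrier_mat n m"
  shows "psd_mat (U * P * mat_adjoint U)"
proof (rule psd_matI)
  show "mat_adjoint (U * P * mat_adjoint U) = U * P * mat_adjoint U"
    using adjoint_conj P U psd_matD(1) by blast
  show "0 \<le> quad_form (U * P * mat_adjoint U) v" if v: "v \<in> carrier_vec n" for v
    unfolding quad_form_conj[OF P(1) U v]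
    by (rule psd_matD(2)[OF P(2,1)]) (use U v in \<open>metis adjoint_carrier mult_mat_vec_carrier\<close>)
qed (use U in auto)

lemma psd_mat_diag:
  assumes "\<And>i. i < n \<Longrightarrow> 0 \<le> l i"
  shows "psd_mat (mat_diag n (\<lambda>i. complex_of_real (l i)))"
proof (rule psd_matI[OF mat_diag_dim])
  let ?D = "mat_diag n (\<lambda>i. complex_of_real (l i))"
  show "mat_adjoint ?D = ?D" by (rule eq_matI) (auto simp: mat_diag_def)
  fix v :: "complex vec" assume v: "v \<in> carrier_vec n"
  have "(?D *\<^sub>v v) $ i = of_real (l i) * v $ i" if "i < n" for i
    using that v by (simp add: mat_diag_def scalar_prod_def if_distrib[of "\<lambda>x. x * _"] cong: if_cong)
  then have "quad_form ?D v = (\<Sum>i<n. l i * (cmod (v $ i))\<^sup>2)"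
    unfolding quad_form_def using v
    by (simp add: cscalar_prod_sum cmod_def) (simp add: power2_eq_square algebra_simps)
  then show "0 \<le> quad_form ?D v" using assms by (auto intro!: sum_nonneg)
qed

lemma psd_gram:
  assumes "S \<in> carrier_mat m n"
  shows "psd_mat (mat_adjoint S * S)"
proof (rule psd_matI)
  show "mat_adjoint (mat_adjoint S * S) = mat_adjoint S * S"
    using assms adjoint_mult[of "mat_adjoint S" n m S n] by auto
  show "0 \<le> quad_form (mat_adjoint S * S) v" if "v \<in> carrier_vec n" for v
    unfolding quad_form_gram[OF assms that]
    using Re_cscalar_prod_self[of "S *\<^sub>v v" m] assms that by (simp add: sum_nonneg)
qed (use assms in auto)

lemma psd_sqrt_exists:
  assumes A: "A \<in> carrier_mat n n" "psd_mat A"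
  shows "\<exists>P \<in> carrier_mat n n. psd_mat P \<and> P * P = A"
proof -
  obtain e l where e: "orthonormal_on n {..<n} e"
    and ql: "\<And>i. i < n \<Longrightarrow> quad_form A (e i) = l i"
    and A_eq: "A = family_mat n n e * mat_diag n (\<lambda>i. of_real (l i)) * mat_adjoint (family_mat n n e)"
    using spectral_decomposition[OF A(1) psd_matD(1)[OF A(2,1)]] by metis
  have l: "0 \<le> l i" if "i < n" for i
    using psd_matD(2)[OF A(2,1), of "e i"] ql e that unfolding orthonormal_on_def by auto
  define Z where "Z = family_mat n n e"
  define D where "D = mat_diag n (\<lambda>i. complex_of_real (sqrt (l i)))"
  have Z: "Z \<in> carrier_mat n n" and D: "D \<in> carrier_mat n n" unfolding Z_def D_def by auto
  have ZZ: "mat_adjoint Z * Z = 1\<^sub>m n" unfolding Z_def by (rule family_mat_isometry[OF e])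
  have "D * D = mat_diag n (\<lambda>i. of_real (l i))"
    unfolding D_def mat_diag_diag using l
    by (auto simp: mat_diag_def simp flip: of_real_mult intro!: eq_matI)
  moreover have "(Z * D * mat_adjoint Z) * (Z * D * mat_adjoint Z)
      = Z * D * (mat_adjoint Z * Z) * D * mat_adjoint Z"
    using Z D by (simp add: assoc_mult_mat[of _ n n _ n _ n] mult_carrier_mat[of _ n n _ n])
  moreover have "\<dots> = Z * (D * D) * mat_adjoint Z"
    unfolding ZZ using Z D by (simp add: assoc_mult_mat[of _ n n _ n _ n] mult_carrier_mat[of _ n n _ n])
  ultimately have "(Z * D * mat_adjoint Z) * (Z * D * mat_adjoint Z) = A"
    using A_eq unfolding Z_def by simp
  moreover have "psd_mat (Z * D * mat_adjoint Z)"
    by (rule psd_conj[OF D _ Z]) (use psd_mat_diag l in \<open>simp add: D_def\<close>)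
  ultimately show ?thesis using Z D by (intro bexI[of _ "Z * D * mat_adjoint Z"]) auto
qed

lemma psd_if_eigenvalues_nonneg:
  assumes A: "A \<in> carrier_mat n n" "mat_adjoint A = A"
    and nonneg: "\<And>v c. v \<in> carrier_vec n \<Longrightarrow> v \<bullet>c v = 1 \<Longrightarrow>
      A *\<^sub>v v = of_real c \<cdot>\<^sub>v v \<Longrightarrow> 0 \<le> c"
  shows "psd_mat A"
proof -
  obtain e l where e: "orthonormal_on n {..<n} e"
    and eig: "\<And>i. i < n \<Longrightarrow> A *\<^sub>v e i = of_real (l i) \<cdot>\<^sub>v e i"
    and A_eq: "A = family_mat n n e * mat_diag n (\<lambda>i. of_real (l i)) * mat_adjoint (family_mat n n e)"
    using spectral_decomposition[OF A] by metis
  have "0 \<le> l i" if "i < n" for i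
    using nonneg[OF _ _ eig[OF that]] e that unfolding orthonormal_on_def by auto
  then show ?thesis by (subst A_eq) (intro psd_conj[OF mat_diag_dim _ family_mat_carrier] psd_mat_diag, auto)
qed

text \<open>Operator monotonicity of the square root. If \<open>v\<close> is a unit eigenvector of \<open>P - Q\<close> with
  eigenvalue \<open>c\<close>, then \<open>\<langle>P\<^sup>2v,v\<rangle> - \<langle>Q\<^sup>2v,v\<rangle> = c (\<langle>Pv,v\<rangle> + \<langle>Qv,v\<rangle>)\<close>, while
  \<open>\<langle>Pv,v\<rangle> - \<langle>Qv,v\<rangle> = c\<close>. If \<open>c\<close> were negative, the first identity would make both nonnegative
  numbers \<open>\<langle>Pv,v\<rangle>\<close> and \<open>\<langle>Qv,v\<rangle>\<close> vanish, and the second would give \<open>c = 0\<close>.\<close>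

lemma psd_mono_of_square_mono:
  assumes P: "P \<in> carrier_mat n n" "psd_mat P" and Q: "Q \<in> carrier_mat n n" "psd_mat Q"
    and mono: "\<And>v. v \<in> carrier_vec n \<Longrightarrow> quad_form (Q * Q) v \<le> quad_form (P * P) v"
  shows "psd_mat (P - Q)"
proof (rule psd_if_eigenvalues_nonneg)
  show "P - Q \<in> carrier_mat n n" using Q(1) by (rule minus_carrier_mat)
  note hP = psd_matD(1)[OF P(2,1)] and hQ = psd_matD(1)[OF Q(2,1)]
  show "mat_adjoint (P - Q) = P - Q" using adjoint_minus[OF P(1) Q(1)] hP hQ by simp
  fix v c assume v: "v \<in> carrier_vec n" "v \<bullet>c v = 1" and eig: "(P - Q) *\<^sub>v v = complex_of_real c \<cdot>\<^sub>v v"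
  define x where "x = P *\<^sub>v v"
  define y where "y = Q *\<^sub>v v"
  have xy: "x \<in> carrier_vec n" "y \<in> carrier_vec n" unfolding x_def y_def using P Q v by auto
  have diff: "x - y = of_real c \<cdot>\<^sub>v v"
    unfolding x_def y_def using eig P Q v by (simp add: minus_mult_distrib_mat_vec[of _ n n])
  have comp: "x $ i - y $ i = of_real c * v $ i" if "i < n" for i
    using arg_cong[OF diff, of "\<lambda>z. z $ i"] xy v that by simp
  have qP: "quad_form P v = (\<Sum>i<n. Re (x $ i * cnj (v $ i)))"
    and qQ: "quad_form Q v = (\<Sum>i<n. Re (y $ i * cnj (v $ i)))"
    unfolding quad_form_def x_def[symmetric] y_def[symmetric] using v by (simp_all add: cscalar_prod_sum)
  have sq: "quad_form (P * P) v = (\<Sum>i<n. (cmod (x $ i))\<^sup>2)"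
    "quad_form (Q * Q) v = (\<Sum>i<n. (cmod (y $ i))\<^sup>2)"
    using quad_form_gram[OF P(1) v(1)] quad_form_gram[OF Q(1) v(1)] hP hQ
      Re_cscalar_prod_self[OF xy(1)] Re_cscalar_prod_self[OF xy(2)]
    unfolding x_def y_def by simp_all
  have "(cmod (x $ i))\<^sup>2 - (cmod (y $ i))\<^sup>2 = c * (Re (x $ i * cnj (v $ i)) + Re (y $ i * cnj (v $ i)))"
    if "i < n" for i
  proof -
    have "x $ i = y $ i + of_real c * v $ i" using comp[OF that] by (simp add: algebra_simps)
    then show ?thesis unfolding cmod_power2 by (simp add: power2_eq_square algebra_simps)
  qed
  then have "quad_form (P * P) v - quad_form (Q * Q) v = c * (quad_form P v + quad_form Q v)"
    unfolding sq qP qQ sum_subtractf[symmetric] sum.distrib[symmetric] sum_distrib_left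
    by (intro sum.cong) auto
  then have "0 \<le> c * (quad_form P v + quad_form Q v)" using mono[OF v(1)] by simp
  moreover have "0 \<le> quad_form P v" "0 \<le> quad_form Q v"
    using psd_matD(2) P Q v by auto
  moreover have "quad_form P v - quad_form Q v = c"
    using quad_form_minus[OF P(1) Q(1) v(1)] eig v unfolding quad_form_def by simp
  ultimately show "0 \<le> c"
    by (smt (verit) mult_neg_pos)
qed

lemma hermitian_zero_if_quad_form_zero:
  assumes A: "A \<in> carrier_mat n n" "mat_adjoint A = A"
    and zero: "\<And>v. v \<in> carrier_vec n \<Longrightarrow> quad_form A v = 0"
  shows "A = 0\<^sub>m n n"
proof -
  obtain e l where e: "orthonormal_on n {..<n} e"
    and ql: "\<And>i. i < n \<Longrightarrow> quad_form A (e i) = l i"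
    and A_eq: "A = family_mat n n e * mat_diag n (\<lambda>i. of_real (l i)) * mat_adjoint (family_mat n n e)"
    using spectral_decomposition[OF A] by metis
  have "l i = 0" if "i < n" for i
    using zero ql e that unfolding orthonormal_on_def by auto
  then have "mat_diag n (\<lambda>i. complex_of_real (l i)) = 0\<^sub>m n n"
    by (auto simp: mat_diag_def intro!: eq_matI)
  then show ?thesis
    by (subst A_eq) (simp add: right_mult_zero_mat[OF family_mat_carrier]
        left_mult_zero_mat[OF adjoint_carrier[OF family_mat_carrier]])
qed

text \<open>Monotonicity applied in both directions makes \<open>P - Q\<close> and \<open>Q - P\<close> positive
  semidefinite.\<close>

lemma psd_sqrt_unique:
  assumes P: "P \<in> carrier_mat n n" "psd_mat P" and Q: "Q \<in> carrier_mat n n" "psd_mat Q"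
    and eq: "P * P = Q * Q"
  shows "P = Q"
proof -
  have PQ: "psd_mat (P - Q)" and QP: "psd_mat (Q - P)"
    using psd_mono_of_square_mono[OF P Q] psd_mono_of_square_mono[OF Q P] eq by auto
  have c: "P - Q \<in> carrier_mat n n" "Q - P \<in> carrier_mat n n" using P Q by auto
  have "P - Q = 0\<^sub>m n n"
  proof (rule hermitian_zero_if_quad_form_zero[OF c(1) psd_matD(1)[OF PQ c(1)]])
    fix v :: "complex vec" assume v: "v \<in> carrier_vec n"
    show "quad_form (P - Q) v = 0"
      using psd_matD(2)[OF PQ c(1) v] psd_matD(2)[OF QP c(2) v]
        quad_form_minus[OF P(1) Q(1) v] quad_form_minus[OF Q(1) P(1) v] by simp
  qed
  then have diff: "(P - Q) $$ (i, j) = 0" if "i < n" "j < n" for i j using that by simp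
  have "P $$ (i, j) = Q $$ (i, j)" if "i < n" "j < n" for i j
    using diff[OF that] index_minus_mat(1)[of i Q j P] that Q by simp
  then show ?thesis using P Q by (intro eq_matI) auto
qed

text \<open>Existence and uniqueness of the square root turn the definite description in \<open>psd_sqrt\<close>
  into these defining properties of \<open>|S|\<close>, the only ones used below.\<close>

lemma mat_abs:
  assumes S: "S \<in> carrier_mat m n"
  shows "mat_abs S \<in> carrier_mat n n" "psd_mat (mat_abs S)"
    "mat_abs S * mat_abs S = mat_adjoint S * S"
proof -
  have G: "mat_adjoint S * S \<in> carrier_mat n n" using S by auto
  obtain P where P: "P \<in> carrier_mat n n" "psd_mat P" "P * P = mat_adjoint S * S"
    using psd_sqrt_exists[OF G psd_gram[OF S]] by blast
  have "mat_abs S = P"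
    unfolding mat_abs_def psd_sqrt_def
  proof (rule the_equality)
    fix R assume R: "psd_mat R \<and> R * R = mat_adjoint S * S"
    then have "R * R \<in> carrier_mat n n" using G by simp
    then have "dim_row R = n" "dim_col R = n"
      using carrier_matD[of "R * R" n n] by simp_all
    then show "R = P" using psd_sqrt_unique[of R n P] R P by (auto intro: carrier_matI)
  qed (use P in auto)
  then show "mat_abs S \<in> carrier_mat n n" "psd_mat (mat_abs S)"
    "mat_abs S * mat_abs S = mat_adjoint S * S" using P by auto
qed

section \<open>Polar decomposition\<close>

text \<open>Let \<open>e\<close> be an orthonormal eigenbasis of \<open>P\<close> with eigenvalues \<open>l\<close>. The vectors \<open>F e i\<close> are
  orthogonal of length \<open>\<bar>l i\<bar>\<close>, so \<open>F e i = l i g i\<close> for an orthonormal family \<open>g\<close>: it is forced where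
  \<open>l i \<noteq> 0\<close> and is filled up arbitrarily elsewhere, for which \<open>m \<le> n\<close> provides the room. The
  isometry sends \<open>e i\<close> to \<open>g i\<close>. Thanks to the filling, \<open>U\<close> is an isometry even if \<open>F\<close> is not
  injective.\<close>

lemma tall_polar:
  fixes F P :: "complex mat"
  assumes F: "F \<in> carrier_mat n m" and P: "P \<in> carrier_mat m m" "mat_adjoint P = P"
    and "m \<le> n" and FF: "mat_adjoint F * F = P * P"
  shows "\<exists>U \<in> carrier_mat n m. mat_adjoint U * U = 1\<^sub>m m \<and> F = U * P"
proof -
  obtain e l where e: "orthonormal_on m {..<m} e"
    and eig: "\<And>i. i < m \<Longrightarrow> P *\<^sub>v e i = of_real (l i) \<cdot>\<^sub>v e i"
    and P_eq: "P = family_mat m m e * mat_diag m (\<lambda>i. of_real (l i)) * mat_adjoint (family_mat m m e)"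
    using spectral_decomposition[OF P] by metis
  have ec: "e i \<in> carrier_vec m" if "i < m" for i
    using e that unfolding orthonormal_on_def by auto
  have Fe: "F *\<^sub>v e i \<in> carrier_vec n" if "i < m" for i using F ec[OF that] by simp
  have inner: "(F *\<^sub>v e i) \<bullet>c (F *\<^sub>v e j) = (if i = j then of_real (l i * l i) else 0)"
    if ij: "i < m" "j < m" for i j
  proof -
    have Pe: "P *\<^sub>v e j \<in> carrier_vec m" using P ec ij by simp
    have "(F *\<^sub>v e i) \<bullet>c (F *\<^sub>v e j) = e i \<bullet>c (mat_adjoint F *\<^sub>v (F *\<^sub>v e j))"
      by (rule cscalar_prod_adjoint[OF F ec[OF ij(1)] Fe[OF ij(2)]])
    also have "mat_adjoint F *\<^sub>v (F *\<^sub>v e j) = P *\<^sub>v (P *\<^sub>v e j)"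
      using F P ec ij FF by (metis adjoint_carrier assoc_mult_mat_vec)
    also have "e i \<bullet>c (P *\<^sub>v (P *\<^sub>v e j)) = (P *\<^sub>v e i) \<bullet>c (P *\<^sub>v e j)"
      using cscalar_prod_adjoint[OF P(1) ec[OF ij(1)] Pe] P(2) by simp
    also have "\<dots> = of_real (l i * l j) * (e i \<bullet>c e j)"
      using eig ij ec[OF ij(1)] ec[OF ij(2)] by (simp add: conjugate_smult_vec)
    finally show ?thesis using e ij unfolding orthonormal_on_def by auto
  qed
  define J where "J = {i. i < m \<and> l i \<noteq> 0}"
  define f where "f i = of_real (1 / l i) \<cdot>\<^sub>v (F *\<^sub>v e i)" for i
  have "orthonormal_on n J f"
    unfolding orthonormal_on_def
  proof (intro conjI ballI)
    show "f i \<in> carrier_vec n" if "i \<in> J" for i using that Fe unfolding J_def f_def by auto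
    show "f i \<bullet>c f j = (if i = j then 1 else 0)" if "i \<in> J" "j \<in> J" for i j
    proof -
      have ij: "i < m" "j < m" "l i \<noteq> 0" using that unfolding J_def by auto
      have "f i \<bullet>c f j = of_real (1 / l i * (1 / l j)) * ((F *\<^sub>v e i) \<bullet>c (F *\<^sub>v e j))"
        unfolding f_def using Fe[OF ij(1)] Fe[OF ij(2)] by (simp add: conjugate_smult_vec)
      then show ?thesis using inner[OF ij(1,2)] ij(3) by auto
    qed
  qed
  then obtain g where g: "orthonormal_on n {..<m} g" and gf: "\<forall>i\<in>J. g i = f i"
    using orthonormal_extend[of "{..<m}" n J f] \<open>m \<le> n\<close> unfolding J_def by auto
  have gc: "g i \<in> carrier_vec n" if "i < m" for i
    using g that unfolding orthonormal_on_def by auto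
  have Fg: "F *\<^sub>v e i = of_real (l i) \<cdot>\<^sub>v g i" if i: "i < m" for i
  proof (cases "l i = 0")
    case True
    then have "F *\<^sub>v e i = 0\<^sub>v n"
      using inner[OF i i] conjugate_square_eq_0_vec[OF Fe[OF i]] by simp
    then show ?thesis using True gc[OF i] by (auto intro!: eq_vecI)
  next
    case False
    then have "of_real (l i) \<cdot>\<^sub>v g i = (of_real (l i) * of_real (1 / l i)) \<cdot>\<^sub>v (F *\<^sub>v e i)"
      using gf i unfolding J_def f_def by (simp add: smult_smult_assoc)
    also have "complex_of_real (l i) * of_real (1 / l i) = 1" using False by simp
    finally show ?thesis by simp
  qed
  define Z where "Z = family_mat m m e"
  define E where "E = family_mat n m g"
  define D where "D = mat_diag m (\<lambda>i. complex_of_real (l i))"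
  have Z: "Z \<in> carrier_mat m m" and E: "E \<in> carrier_mat n m" and D: "D \<in> carrier_mat m m"
    unfolding Z_def E_def D_def by auto
  have ZZ: "mat_adjoint Z * Z = 1\<^sub>m m" "Z * mat_adjoint Z = 1\<^sub>m m"
    and EE: "mat_adjoint E * E = 1\<^sub>m m"
    unfolding Z_def E_def using family_mat_isometry family_mat_unitary e g by auto
  have "F * Z = family_mat n m (\<lambda>i. of_real (l i) \<cdot>\<^sub>v g i)"
    unfolding Z_def using mult_family_mat[OF F ec] Fg by (auto simp: family_mat_def intro!: eq_matI)
  then have FZ: "F * Z = E * D" unfolding E_def D_def using family_mat_smult[OF gc] by simp
  define U where "U = E * mat_adjoint Z"
  have U: "U \<in> carrier_mat n m" unfolding U_def using E Z by auto
  have "mat_adjoint U * U = Z * (mat_adjoint E * E) * mat_adjoint Z"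
    unfolding U_def using E Z
    by (simp add: adjoint_mult[of _ n m _ m] assoc_mult_mat[of _ m n _ m _ m]
        assoc_mult_mat[of _ m m _ n _ m] assoc_mult_mat[of _ m m _ m _ m]
        mult_carrier_mat[of _ m n _ m] mult_carrier_mat[of _ n m _ m])
  then have UU: "mat_adjoint U * U = 1\<^sub>m m" unfolding EE using Z ZZ by simp
  have "U * P = E * (mat_adjoint Z * Z) * D * mat_adjoint Z"
    unfolding U_def P_eq Z_def[symmetric] D_def[symmetric] using E Z D
    by (simp add: assoc_mult_mat[of _ n m _ m _ m] assoc_mult_mat[of _ m m _ m _ m]
        mult_carrier_mat[of _ n m _ m] mult_carrier_mat[of _ m m _ m])
  also have "\<dots> = F * Z * mat_adjoint Z" unfolding ZZ FZ using E by simp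
  also have "\<dots> = F" using F Z ZZ by (simp add: assoc_mult_mat[of _ n m _ m _ m])
  finally show ?thesis using U UU by auto
qed

section \<open>Cutting a block in two\<close>

text \<open>Blocks are addressed by coordinates in the original matrix, so that cutting a block only
  changes the coordinates and never nests submatrices.\<close>

definition block :: "complex mat \<Rightarrow> nat \<Rightarrow> nat \<Rightarrow> nat \<Rightarrow> nat \<Rightarrow> complex mat" where
  "block M a b g h = mat (b - a) (h - g) (\<lambda>(i, j). M $$ (a + i, g + j))"

lemma block_carrier [simp]: "block M a b g h \<in> carrier_mat (b - a) (h - g)"
  unfolding block_def by simp

lemma dim_block [simp]: "dim_row (block M a b g h) = b - a" "dim_col (block M a b g h) = h - g"
  unfolding block_def by auto

lemma block_index [simp]:
  "i < b - a \<Longrightarrow> j < h - g \<Longrightarrow> block M a b g h $$ (i, j) = M $$ (a + i, g + j)"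
  unfolding block_def by simp

lemma pick_atLeastLessThan:
  assumes "i < b - a"
  shows "pick {a..<b} i = a + i"
proof -
  have "{k \<in> {a..<b}. k < a + i} = {a..<a + i}" using assms by auto
  then show ?thesis using pick_card_in_set[of "a + i" "{a..<b}"] assms by simp
qed

lemma submatrix_eq_block:
  assumes "b \<le> dim_row M" "h \<le> dim_col M"
  shows "submatrix M {a..<b} {g..<h} = block M a b g h"
proof -
  have "{i. i < dim_row M \<and> i \<in> {a..<b}} = {a..<b}" "{j. j < dim_col M \<and> j \<in> {g..<h}} = {g..<h}"
    using assms by auto
  then show ?thesis
    by (intro eq_matI) (simp_all add: dim_submatrix submatrix_index pick_atLeastLessThan
        del: mem_Collect_eq atLeastLessThan_iff)
qed

lemma block_whole: "M \<in> carrier_mat d d' \<Longrightarrow> block M 0 d 0 d' = M"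
  by (rule eq_matI) simp_all

lemma sum_shift_interval: "(\<Sum>i<b - a. f (a + i)) = (\<Sum>i=a..<b. f i)" for a b :: nat
  using sum.shift_bounds_nat_ivl[of f 0 a "b - a"]
  by (cases "a \<le> b") (simp_all add: lessThan_atLeast0 add.commute)

lemma gram_block_index:
  assumes "i < h - g" "j < h - g"
  shows "(mat_adjoint (block M a b g h) * block M a b g h) $$ (i, j)
    = (\<Sum>k=a..<b. M $$ (k, g + j) * cnj (M $$ (k, g + i)))"
  using assms
  by (subst adjoint_mult_index[OF block_carrier block_carrier])
    (auto simp flip: sum_shift_interval)

lemma gram_split_rows:
  assumes "a \<le> x" "x \<le> b"
  shows "mat_adjoint (block M a b g h) * block M a b g h
    = mat_adjoint (block M a x g h) * block M a x g h
      + mat_adjoint (block M x b g h) * block M x b g h"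
proof (rule eq_matI)
  fix i j
  assume "i < dim_row (mat_adjoint (block M a x g h) * block M a x g h
      + mat_adjoint (block M x b g h) * block M x b g h)"
    "j < dim_col (mat_adjoint (block M a x g h) * block M a x g h
      + mat_adjoint (block M x b g h) * block M x b g h)"
  then have ij: "i < h - g" "j < h - g" by auto
  show "(mat_adjoint (block M a b g h) * block M a b g h) $$ (i, j)
    = (mat_adjoint (block M a x g h) * block M a x g h
      + mat_adjoint (block M x b g h) * block M x b g h) $$ (i, j)"
    using ij assms
    by (simp add: gram_block_index sum.atLeastLessThan_concat del: index_mult_mat(1))
qed auto

text \<open>Both sides are the same principal submatrix of \<open>|B|\<^sup>2 = B\<^sup>*B\<close>, where \<open>B\<close> is the big block: a group of
  columns of the square matrix \<open>|B|\<close> has the same inner products as those columns of \<open>B\<close>.\<close>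

lemma gram_abs_columns:
  assumes "y \<le> y'" "y' \<le> h - g"
  shows "mat_adjoint (block (mat_abs (block M a b g h)) 0 (h - g) y y')
      * block (mat_abs (block M a b g h)) 0 (h - g) y y'
    = mat_adjoint (block M a b (g + y) (g + y')) * block M a b (g + y) (g + y')"
    (is "mat_adjoint ?X * ?X = mat_adjoint ?B * ?B")
proof (rule eq_matI)
  let ?P = "mat_abs (block M a b g h)"
  note P = mat_abs[OF block_carrier[of M a b g h]]
  fix i j assume "i < dim_row (mat_adjoint ?B * ?B)" "j < dim_col (mat_adjoint ?B * ?B)"
  then have ij: "i < y' - y" "j < y' - y" by auto
  have ij': "y + i < h - g" "y + j < h - g" using ij assms by auto
  have "(mat_adjoint ?X * ?X) $$ (i, j) = (\<Sum>k<h - g. ?P $$ (k, y + j) * cnj (?P $$ (k, y + i)))"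
    using gram_block_index[OF ij] by (simp add: lessThan_atLeast0)
  also have "\<dots> = (mat_adjoint ?P * ?P) $$ (y + i, y + j)"
    by (rule adjoint_mult_index[OF P(1) P(1) ij', symmetric])
  also have "\<dots> = (\<Sum>k=a..<b. M $$ (k, g + (y + j)) * cnj (M $$ (k, g + (y + i))))"
    using psd_matD(1)[OF P(2,1)] P(3) gram_block_index[OF ij'] by simp
  also have "\<dots> = (mat_adjoint ?B * ?B) $$ (i, j)"
    using ij by (subst gram_block_index) (auto simp: add.assoc)
  finally show "(mat_adjoint ?X * ?X) $$ (i, j) = (mat_adjoint ?B * ?B) $$ (i, j)" .
qed auto

lemma mult_adjoint_split_columns:
  assumes P: "P \<in> carrier_mat n m" and "y \<le> m"
  shows "P * mat_adjoint P = block P 0 n 0 y * mat_adjoint (block P 0 n 0 y)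
    + block P 0 n y m * mat_adjoint (block P 0 n y m)" (is "_ = ?X * _ + ?Y * _")
proof (rule eq_matI)
  fix i j
  assume "i < dim_row (?X * mat_adjoint ?X + ?Y * mat_adjoint ?Y)"
    "j < dim_col (?X * mat_adjoint ?X + ?Y * mat_adjoint ?Y)"
  then have ij: "i < n" "j < n" by auto
  let ?f = "\<lambda>k. P $$ (i, k) * cnj (P $$ (j, k))"
  have "(P * mat_adjoint P) $$ (i, j) = (\<Sum>k=0..<m. ?f k)"
    using P ij by (simp add: scalar_prod_def)
  also have "\<dots> = (\<Sum>k=0..<y. ?f k) + (\<Sum>k=y..<m. ?f k)"
    using \<open>y \<le> m\<close> by (simp add: sum.atLeastLessThan_concat)
  also have "(\<Sum>k=0..<y. ?f k) = (?X * mat_adjoint ?X) $$ (i, j)"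
    using ij by (simp add: scalar_prod_def)
  also have "(\<Sum>k=y..<m. ?f k) = (?Y * mat_adjoint ?Y) $$ (i, j)"
    using ij by (simp add: scalar_prod_def flip: sum_shift_interval lessThan_atLeast0)
  finally show "(P * mat_adjoint P) $$ (i, j) = (?X * mat_adjoint ?X + ?Y * mat_adjoint ?Y) $$ (i, j)"
    using ij by simp
qed (use P in auto)

lemma conj_square:
  fixes U P :: "complex mat"
  assumes U: "U \<in> carrier_mat n m" "mat_adjoint U * U = 1\<^sub>m m"
    and P: "P \<in> carrier_mat m m" "mat_adjoint P = P"
  shows "(U * P) * mat_adjoint (U * P)
    = (U * P * mat_adjoint U) * (U * P * mat_adjoint U)"
proof -
  have Ut: "mat_adjoint U \<in> carrier_mat m n" using U by simp
  have "(U * P * mat_adjoint U) * (U * P * mat_adjoint U)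
      = U * P * (mat_adjoint U * U) * (P * mat_adjoint U)"
    using U(1) P Ut
    by (simp add: assoc_mult_mat[of _ n m _ m _ n] assoc_mult_mat[of _ n m _ n _ n]
        assoc_mult_mat[of _ m n _ m _ n] assoc_mult_mat[of _ n m _ m _ m] assoc_mult_mat[of _ m m _ m _ n]
        assoc_mult_mat[of _ m m _ n _ n] mult_carrier_mat[of _ n m _ m] mult_carrier_mat[of _ m m _ n] mult_carrier_mat[of _ n m _ n]
        mult_carrier_mat[of _ m n _ m] mult_carrier_mat[of _ m n _ n])
  also have "\<dots> = (U * P) * mat_adjoint (U * P)"
    unfolding U(2) using U(1) P Ut adjoint_mult[OF U(1) P(1)] by simp
  finally show ?thesis by simp
qed

text \<open>The identity \<open>|B|\<^sup>2 = Q\<^sub>1\<^sup>2 + Q\<^sub>2\<^sup>2\<close> with \<open>Q\<^sub>i\<close> isometrically congruent to \<open>|B\<^sub>i|\<close>. Horizontal and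
  vertical cuts both have this property, and nothing else about a cut enters the estimates.\<close>

definition abs_splits :: "complex mat \<Rightarrow> complex mat \<Rightarrow> complex mat \<Rightarrow> bool" where
  "abs_splits B B1 B2 \<longleftrightarrow>
    (\<exists>V1 \<in> carrier_mat (dim_col B) (dim_col B1). \<exists>V2 \<in> carrier_mat (dim_col B) (dim_col B2).
      mat_adjoint V1 * V1 = 1\<^sub>m (dim_col B1) \<and> mat_adjoint V2 * V2 = 1\<^sub>m (dim_col B2) \<and>
      mat_abs B * mat_abs B
        = (V1 * mat_abs B1 * mat_adjoint V1) * (V1 * mat_abs B1 * mat_adjoint V1)
          + (V2 * mat_abs B2 * mat_adjoint V2) * (V2 * mat_abs B2 * mat_adjoint V2))"

lemma abs_splits_rows:
  assumes "a \<le> x" "x \<le> b"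
  shows "abs_splits (block M a b g h) (block M a x g h) (block M x b g h)"
proof -
  note abs = mat_abs[OF block_carrier[of M _ _ g h]]
  have "mat_abs (block M a b g h) * mat_abs (block M a b g h)
    = mat_abs (block M a x g h) * mat_abs (block M a x g h)
      + mat_abs (block M x b g h) * mat_abs (block M x b g h)"
    unfolding abs(3) by (rule gram_split_rows[OF assms])
  then show ?thesis
    unfolding abs_splits_def
    by (intro bexI[of _ "1\<^sub>m (h - g)"] conjI)
      (simp_all add: left_mult_one_mat[OF abs(1)] right_mult_one_mat[OF abs(1)])
qed

text \<open>The same line cuts \<open>P = |B|\<close> into \<open>[X Y]\<close>. Computing \<open>P\<^sup>2\<close> as \<open>PP\<^sup>*\<close> gives \<open>XX\<^sup>* + YY\<^sup>*\<close>, computing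
  it as \<open>P\<^sup>*P\<close> identifies \<open>X\<^sup>*X\<close> and \<open>Y\<^sup>*Y\<close>, and the polar decomposition passes from \<open>X\<^sup>*X\<close> to \<open>XX\<^sup>*\<close>.\<close>

lemma abs_splits_columns:
  assumes "g \<le> x" "x \<le> h"
  shows "abs_splits (block M a b g h) (block M a b g x) (block M a b x h)"
proof -
  define n where "n = h - g"
  define m where "m = x - g"
  define P where "P = mat_abs (block M a b g h)"
  note absB = mat_abs[OF block_carrier[of M a b g h], folded P_def n_def]
  note abs1 = mat_abs[OF block_carrier[of M a b g x], folded m_def]
  have nm: "m \<le> n" "h - x = n - m" "g + m = x" "g + n = h"
    using assms unfolding n_def m_def by auto
  note abs2 = mat_abs[OF block_carrier[of M a b x h], unfolded nm(2)]
  have hP: "mat_adjoint P = P" by (rule psd_matD(1)[OF absB(2,1)])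
  let ?X = "block P 0 n 0 m" and ?Y = "block P 0 n m n"
  have X: "?X \<in> carrier_mat n m" and Y: "?Y \<in> carrier_mat n (n - m)"
    using block_carrier[of P 0 n 0 m] block_carrier[of P 0 n m n] by simp_all
  have XX: "mat_adjoint ?X * ?X = mat_abs (block M a b g x) * mat_abs (block M a b g x)"
    and YY: "mat_adjoint ?Y * ?Y = mat_abs (block M a b x h) * mat_abs (block M a b x h)"
    using gram_abs_columns[of 0 m h g M a b] gram_abs_columns[of m n h g M a b] nm
    unfolding abs1(3) abs2(3) P_def n_def by auto
  obtain V1 where V1: "V1 \<in> carrier_mat n m" "mat_adjoint V1 * V1 = 1\<^sub>m m"
    "?X = V1 * mat_abs (block M a b g x)"
    using tall_polar[OF X abs1(1) psd_matD(1)[OF abs1(2,1)] nm(1) XX] by blast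
  obtain V2 where V2: "V2 \<in> carrier_mat n (n - m)" "mat_adjoint V2 * V2 = 1\<^sub>m (n - m)"
    "?Y = V2 * mat_abs (block M a b x h)"
    using tall_polar[OF Y abs2(1) psd_matD(1)[OF abs2(2,1)] _ YY] by auto
  have "P * P = ?X * mat_adjoint ?X + ?Y * mat_adjoint ?Y"
    using mult_adjoint_split_columns[OF absB(1) nm(1)] hP by simp
  also have "?X * mat_adjoint ?X = (V1 * mat_abs (block M a b g x) * mat_adjoint V1)
      * (V1 * mat_abs (block M a b g x) * mat_adjoint V1)"
    unfolding V1(3) by (rule conj_square[OF V1(1,2) abs1(1) psd_matD(1)[OF abs1(2,1)]])
  also have "?Y * mat_adjoint ?Y = (V2 * mat_abs (block M a b x h) * mat_adjoint V2)
      * (V2 * mat_abs (block M a b x h) * mat_adjoint V2)"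
    unfolding V2(3) by (rule conj_square[OF V2(1,2) abs2(1) psd_matD(1)[OF abs2(2,1)]])
  finally show ?thesis
    unfolding abs_splits_def using V1(1,2) V2(1,2)
    by (intro bexI[of _ V1] bexI[of _ V2] conjI) (simp_all add: P_def m_def n_def nm(2)[unfolded n_def m_def])
qed

section \<open>From squares to absolute values\<close>

lemma cmod_weighted_sum_square_le:
  fixes p q :: real
  assumes "p\<^sup>2 + q\<^sup>2 = 1"
  shows "(cmod (of_real p * x + of_real q * y))\<^sup>2 \<le> (cmod x)\<^sup>2 + (cmod y)\<^sup>2"
proof -
  have "(p\<^sup>2 + q\<^sup>2) * ((cmod x)\<^sup>2 + (cmod y)\<^sup>2) - (cmod (of_real p * x + of_real q * y))\<^sup>2
      = (q * Re x - p * Re y)\<^sup>2 + (q * Im x - p * Im y)\<^sup>2"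
    unfolding cmod_power2 by (simp add: power2_eq_square algebra_simps)
  then show ?thesis using assms by (metis diff_ge_0_iff_ge mult_1 sum_power2_ge_zero)
qed

text \<open>The Cauchy-Schwarz inequality, coordinate by coordinate, bounds
  \<open>(p Q1 + q Q2)\<^sup>2\<close> by \<open>Q1\<^sup>2 + Q2\<^sup>2 = P\<^sup>2\<close>; monotonicity of the square root removes the squares.\<close>

lemma weighted_sum_le_of_squares:
  fixes p q :: real
  assumes P: "P \<in> carrier_mat n n" "psd_mat P"
    and Q1: "Q1 \<in> carrier_mat n n" "psd_mat Q1" and Q2: "Q2 \<in> carrier_mat n n" "psd_mat Q2"
    and eq: "P * P = Q1 * Q1 + Q2 * Q2"
    and pq: "0 \<le> p" "0 \<le> q" "p\<^sup>2 + q\<^sup>2 = 1" and v: "v \<in> carrier_vec n"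
  shows "p * quad_form Q1 v + q * quad_form Q2 v \<le> quad_form P v"
proof -
  define Q where "Q = of_real p \<cdot>\<^sub>m Q1 + of_real q \<cdot>\<^sub>m Q2"
  have c: "of_real p \<cdot>\<^sub>m Q1 \<in> carrier_mat n n" "of_real q \<cdot>\<^sub>m Q2 \<in> carrier_mat n n"
    using Q1 Q2 by auto
  have Q: "Q \<in> carrier_mat n n" unfolding Q_def using c by simp
  have qQ: "quad_form Q w = p * quad_form Q1 w + q * quad_form Q2 w" if "w \<in> carrier_vec n" for w
    unfolding Q_def quad_form_add[OF c that] quad_form_smult[OF Q1(1) that] quad_form_smult[OF Q2(1) that] ..
  note h = psd_matD(1)[OF P(2,1)] psd_matD(1)[OF Q1(2,1)] psd_matD(1)[OF Q2(2,1)]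
  have hQ: "mat_adjoint Q = Q"
    unfolding Q_def adjoint_add[OF c] adjoint_smult_real h ..
  have psdQ: "psd_mat Q"
    using psd_matD(2)[OF Q1(2,1)] psd_matD(2)[OF Q2(2,1)] pq qQ
    by (intro psd_matI[OF Q hQ]) simp
  have "quad_form (Q * Q) w \<le> quad_form (P * P) w" if w: "w \<in> carrier_vec n" for w
  proof -
    define x where "x = Q1 *\<^sub>v w"
    define y where "y = Q2 *\<^sub>v w"
    have xy: "x \<in> carrier_vec n" "y \<in> carrier_vec n" unfolding x_def y_def using Q1 Q2 w by auto
    have Qw: "Q *\<^sub>v w = of_real p \<cdot>\<^sub>v x + of_real q \<cdot>\<^sub>v y"
      unfolding Q_def x_def y_def using c Q1 Q2 w
      by (simp add: add_mult_distrib_mat_vec[of _ n n] smult_mult_mat_vec[of _ n n])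
    have Qwc: "Q *\<^sub>v w \<in> carrier_vec n" using Q w by simp
    have "quad_form (Q * Q) w = (\<Sum>i<n. (cmod (of_real p * x $ i + of_real q * y $ i))\<^sup>2)"
      using quad_form_gram[OF Q w] Re_cscalar_prod_self[OF Qwc] xy unfolding hQ
      by (simp add: Qw)
    also have "\<dots> \<le> (\<Sum>i<n. (cmod (x $ i))\<^sup>2 + (cmod (y $ i))\<^sup>2)"
      by (intro sum_mono cmod_weighted_sum_square_le pq)
    also have "\<dots> = quad_form (Q1 * Q1) w + quad_form (Q2 * Q2) w"
      using quad_form_gram[OF Q1(1) w] quad_form_gram[OF Q2(1) w]
        Re_cscalar_prod_self[OF xy(1)] Re_cscalar_prod_self[OF xy(2)]
      unfolding h x_def y_def by (simp add: sum.distrib)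
    also have "\<dots> = quad_form (P * P) w"
      unfolding eq using Q1 Q2 w by (subst quad_form_add) auto
    finally show ?thesis .
  qed
  then have psd: "psd_mat (P - Q)" by (rule psd_mono_of_square_mono[OF P Q psdQ])
  have "0 \<le> quad_form (P - Q) v"
    by (rule psd_matD(2)[OF psd _ v]) (rule minus_carrier_mat[OF Q])
  then show ?thesis using quad_form_minus[OF P(1) Q v] qQ[OF v] by simp
qed

text \<open>The assertion \<open>\<surd>n |B| \<ge> \<Sum> U\<^sub>k |A\<^sub>k| U\<^sub>k\<^sup>*\<close> for \<open>n\<close> matrices, with the Loewner order tested on
  vectors.\<close>

definition abs_dominates :: "complex mat \<Rightarrow> 'i set \<Rightarrow> ('i \<Rightarrow> complex mat) \<Rightarrow> bool" where
  "abs_dominates B S A \<longleftrightarrow>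
    (\<exists>U. (\<forall>k\<in>S. U k \<in> carrier_mat (dim_col B) (dim_col (A k)) \<and>
          mat_adjoint (U k) * U k = 1\<^sub>m (dim_col (A k))) \<and>
      (\<forall>v \<in> carrier_vec (dim_col B).
        (\<Sum>k\<in>S. quad_form (U k * mat_abs (A k) * mat_adjoint (U k)) v)
          \<le> sqrt (card S) * quad_form (mat_abs B) v))"

lemma abs_dominates_singleton: "abs_dominates B {k} (\<lambda>_. B)"
proof -
  have "mat_abs B \<in> carrier_mat (dim_col B) (dim_col B)" using mat_abs(1)[of B] by auto
  then show ?thesis
    unfolding abs_dominates_def by (intro exI[of _ "\<lambda>_. 1\<^sub>m (dim_col B)"]) auto
qed

lemma isometry_mult:
  fixes U V :: "complex mat"
  assumes "V \<in> carrier_mat n m" "mat_adjoint V * V = 1\<^sub>m m"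
    and "U \<in> carrier_mat m k" "mat_adjoint U * U = 1\<^sub>m k"
  shows "mat_adjoint (V * U) * (V * U) = 1\<^sub>m k"
proof -
  have "mat_adjoint (V * U) * (V * U) = mat_adjoint U * ((mat_adjoint V * V) * U)"
    using assms(1,3)
    by (simp add: adjoint_mult[of _ n m _ k] assoc_mult_mat[of _ k m _ n _ k]
        assoc_mult_mat[of _ m n _ m _ k] mult_carrier_mat[of _ n m _ k])
  then show ?thesis using assms by simp
qed

lemma quad_form_conj_mult:
  assumes P: "P \<in> carrier_mat k k" and U: "U \<in> carrier_mat m k" and V: "V \<in> carrier_mat n m"
    and v: "v \<in> carrier_vec n"
  shows "quad_form ((V * U) * P * mat_adjoint (V * U)) v
    = quad_form (U * P * mat_adjoint U) (mat_adjoint V *\<^sub>v v)"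
proof -
  have VU: "V * U \<in> carrier_mat n k" using U V by simp
  have w: "mat_adjoint V *\<^sub>v v \<in> carrier_vec m" by (rule mult_mat_vec_carrier[OF adjoint_carrier[OF V] v])
  have "mat_adjoint (V * U) *\<^sub>v v = mat_adjoint U *\<^sub>v (mat_adjoint V *\<^sub>v v)"
    using U V v by (simp add: adjoint_mult[of _ n m _ k] assoc_mult_mat_vec[of _ k m _ n])
  then show ?thesis by (simp add: quad_form_conj[OF P VU v] quad_form_conj[OF P U w])
qed

text \<open>The weights \<open>\<surd>(n\<^sub>1/n)\<close> and \<open>\<surd>(n\<^sub>2/n)\<close> are chosen so that multiplying by \<open>\<surd>n\<close> reproduces exactly
  the factors \<open>\<surd>n\<^sub>1\<close> and \<open>\<surd>n\<^sub>2\<close> of the two given bounds; equal weights would lose a factor unless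
  \<open>n\<^sub>1 = n\<^sub>2\<close>. The new isometries are the products \<open>V\<^sub>i U\<^sub>k\<close>.\<close>

lemma abs_dominates_union:
  assumes split: "abs_splits B B1 B2"
    and dom: "abs_dominates B1 S1 A" "abs_dominates B2 S2 A"
    and S: "finite S1" "finite S2" "S1 \<inter> S2 = {}" "S1 \<noteq> {}"
  shows "abs_dominates B (S1 \<union> S2) A"
proof -
  define n where "n = dim_col B"
  define n1 where "n1 = dim_col B1"
  define n2 where "n2 = dim_col B2"
  obtain V1 V2 where V1: "V1 \<in> carrier_mat n n1" "mat_adjoint V1 * V1 = 1\<^sub>m n1"
    and V2: "V2 \<in> carrier_mat n n2" "mat_adjoint V2 * V2 = 1\<^sub>m n2"
    and eq: "mat_abs B * mat_abs B
        = (V1 * mat_abs B1 * mat_adjoint V1) * (V1 * mat_abs B1 * mat_adjoint V1)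
          + (V2 * mat_abs B2 * mat_adjoint V2) * (V2 * mat_abs B2 * mat_adjoint V2)"
    using split unfolding abs_splits_def n_def n1_def n2_def by blast
  obtain U1 where U1: "\<And>k. k \<in> S1 \<Longrightarrow> U1 k \<in> carrier_mat n1 (dim_col (A k))"
    "\<And>k. k \<in> S1 \<Longrightarrow> mat_adjoint (U1 k) * U1 k = 1\<^sub>m (dim_col (A k))"
    and le1: "\<And>v. v \<in> carrier_vec n1 \<Longrightarrow>
        (\<Sum>k\<in>S1. quad_form (U1 k * mat_abs (A k) * mat_adjoint (U1 k)) v)
          \<le> sqrt (card S1) * quad_form (mat_abs B1) v"
    using dom(1) unfolding abs_dominates_def n1_def by blast
  obtain U2 where U2: "\<And>k. k \<in> S2 \<Longrightarrow> U2 k \<in> carrier_mat n2 (dim_col (A k))"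
    "\<And>k. k \<in> S2 \<Longrightarrow> mat_adjoint (U2 k) * U2 k = 1\<^sub>m (dim_col (A k))"
    and le2: "\<And>v. v \<in> carrier_vec n2 \<Longrightarrow>
        (\<Sum>k\<in>S2. quad_form (U2 k * mat_abs (A k) * mat_adjoint (U2 k)) v)
          \<le> sqrt (card S2) * quad_form (mat_abs B2) v"
    using dom(2) unfolding abs_dominates_def n2_def by blast
  define U where "U k = (if k \<in> S1 then V1 * U1 k else V2 * U2 k)" for k
  have U_S1: "U k = V1 * U1 k" if "k \<in> S1" for k using that unfolding U_def by simp
  have U_S2: "U k = V2 * U2 k" if "k \<in> S2" for k using that S(3) unfolding U_def by auto
  have abs_A: "mat_abs (A k) \<in> carrier_mat (dim_col (A k)) (dim_col (A k))" for k
    using mat_abs(1)[of "A k"] by auto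
  have absB: "mat_abs B \<in> carrier_mat n n" "psd_mat (mat_abs B)"
    using mat_abs[of B "dim_row B" n] unfolding n_def by auto
  have absB1: "mat_abs B1 \<in> carrier_mat n1 n1" "psd_mat (mat_abs B1)"
    using mat_abs[of B1 "dim_row B1" n1] unfolding n1_def by auto
  have absB2: "mat_abs B2 \<in> carrier_mat n2 n2" "psd_mat (mat_abs B2)"
    using mat_abs[of B2 "dim_row B2" n2] unfolding n2_def by auto
  have iso: "U k \<in> carrier_mat n (dim_col (A k)) \<and> mat_adjoint (U k) * U k = 1\<^sub>m (dim_col (A k))"
    if "k \<in> S1 \<union> S2" for k
    using that
  proof
    assume k: "k \<in> S1"
    show ?thesis unfolding U_S1[OF k]
      using isometry_mult[OF V1 U1(1,2)[OF k]] V1(1) U1(1)[OF k] by simp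
  next
    assume k: "k \<in> S2"
    show ?thesis unfolding U_S2[OF k]
      using isometry_mult[OF V2 U2(1,2)[OF k]] V2(1) U2(1)[OF k] by simp
  qed
  have bound: "(\<Sum>k\<in>S1 \<union> S2. quad_form (U k * mat_abs (A k) * mat_adjoint (U k)) v)
      \<le> sqrt (card (S1 \<union> S2)) * quad_form (mat_abs B) v" if v: "v \<in> carrier_vec n" for v
  proof -
    define N where "N = real (card (S1 \<union> S2))"
    have "0 < card S1" using S by (simp add: card_gt_0_iff)
    then have N: "N = card S1 + card S2" "0 < N"
      unfolding N_def using S by (simp_all add: card_Un_disjoint)
    define p where "p = sqrt (card S1 / N)"
    define q where "q = sqrt (card S2 / N)"
    have pq: "0 \<le> p" "0 \<le> q" "p\<^sup>2 + q\<^sup>2 = 1"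
      unfolding p_def q_def using N by (simp_all add: add_divide_distrib[symmetric])
    have Npq: "sqrt N * p = sqrt (card S1)" "sqrt N * q = sqrt (card S2)"
      unfolding p_def q_def using N(2) by (simp_all add: real_sqrt_mult[symmetric])
    let ?w1 = "mat_adjoint V1 *\<^sub>v v" and ?w2 = "mat_adjoint V2 *\<^sub>v v"
    have w: "?w1 \<in> carrier_vec n1" "?w2 \<in> carrier_vec n2"
      by (rule mult_mat_vec_carrier[OF adjoint_carrier[OF V1(1)] v])
        (rule mult_mat_vec_carrier[OF adjoint_carrier[OF V2(1)] v])
    have "(\<Sum>k\<in>S1 \<union> S2. quad_form (U k * mat_abs (A k) * mat_adjoint (U k)) v)
        = (\<Sum>k\<in>S1. quad_form (U k * mat_abs (A k) * mat_adjoint (U k)) v)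
          + (\<Sum>k\<in>S2. quad_form (U k * mat_abs (A k) * mat_adjoint (U k)) v)"
      by (rule sum.union_disjoint[OF S(1-3)])
    also have "(\<Sum>k\<in>S1. quad_form (U k * mat_abs (A k) * mat_adjoint (U k)) v)
        = (\<Sum>k\<in>S1. quad_form (U1 k * mat_abs (A k) * mat_adjoint (U1 k)) ?w1)"
      using quad_form_conj_mult[OF abs_A U1(1) V1(1) v] by (intro sum.cong) (auto simp: U_S1)
    also have "\<dots> \<le> sqrt (card S1) * quad_form (mat_abs B1) ?w1" by (rule le1[OF w(1)])
    also have "quad_form (mat_abs B1) ?w1 = quad_form (V1 * mat_abs B1 * mat_adjoint V1) v"
      by (rule quad_form_conj[OF absB1(1) V1(1) v, symmetric])
    also have "(\<Sum>k\<in>S2. quad_form (U k * mat_abs (A k) * mat_adjoint (U k)) v)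
        = (\<Sum>k\<in>S2. quad_form (U2 k * mat_abs (A k) * mat_adjoint (U2 k)) ?w2)"
      using quad_form_conj_mult[OF abs_A U2(1) V2(1) v] by (intro sum.cong) (auto simp: U_S2)
    also have "\<dots> \<le> sqrt (card S2) * quad_form (mat_abs B2) ?w2" by (rule le2[OF w(2)])
    also have "quad_form (mat_abs B2) ?w2 = quad_form (V2 * mat_abs B2 * mat_adjoint V2) v"
      by (rule quad_form_conj[OF absB2(1) V2(1) v, symmetric])
    finally have "(\<Sum>k\<in>S1 \<union> S2. quad_form (U k * mat_abs (A k) * mat_adjoint (U k)) v)
        \<le> sqrt N * (p * quad_form (V1 * mat_abs B1 * mat_adjoint V1) v
          + q * quad_form (V2 * mat_abs B2 * mat_adjoint V2) v)"
      unfolding distrib_left mult.assoc[symmetric] Npq by simp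
    also have "\<dots> \<le> sqrt N * quad_form (mat_abs B) v"
    proof (rule mult_left_mono)
      show "p * quad_form (V1 * mat_abs B1 * mat_adjoint V1) v
          + q * quad_form (V2 * mat_abs B2 * mat_adjoint V2) v \<le> quad_form (mat_abs B) v"
        by (rule weighted_sum_le_of_squares[OF absB _ psd_conj[OF absB1 V1(1)] _ psd_conj[OF absB2 V2(1)] eq pq v])
          (use V1(1) V2(1) in auto)
    qed (use N in simp)
    finally show ?thesis unfolding N_def .
  qed
  show ?thesis
    unfolding abs_dominates_def n_def[symmetric] using iso bound by (intro exI[of _ U]) blast
qed

section \<open>Tilings by at most four rectangles\<close>

definition tiling :: "'i set \<Rightarrow> ('i \<Rightarrow> nat) \<Rightarrow> ('i \<Rightarrow> nat) \<Rightarrow> ('i \<Rightarrow> nat) \<Rightarrow> ('i \<Rightarrow> nat)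
    \<Rightarrow> nat \<Rightarrow> nat \<Rightarrow> nat \<Rightarrow> nat \<Rightarrow> bool" where
  "tiling S r r' c c' a b g h \<longleftrightarrow>
    finite S \<and>
    (\<forall>k\<in>S. r k < r' k \<and> c k < c' k \<and> a \<le> r k \<and> r' k \<le> b \<and> g \<le> c k \<and> c' k \<le> h) \<and>
    (\<forall>x\<in>{a..<b}. \<forall>y\<in>{g..<h}. \<exists>!k. k \<in> S \<and> x \<in> {r k..<r' k} \<and> y \<in> {c k..<c' k})"

lemma tiling_transpose: "tiling S r r' c c' a b g h \<Longrightarrow> tiling S c c' r r' g h a b"
  unfolding tiling_def by (simp add: conj_commute conj_left_commute) blast

lemma tilingD:
  assumes "tiling S r r' c c' a b g h" "k \<in> S"
  shows "r k < r' k" "c k < c' k" "a \<le> r k" "r' k \<le> b" "g \<le> c k" "c' k \<le> h"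
  using assms unfolding tiling_def by auto

lemma tiling_cover:
  assumes "tiling S r r' c c' a b g h" "a \<le> x" "x < b" "g \<le> y" "y < h"
  obtains k where "k \<in> S" "r k \<le> x" "x < r' k" "c k \<le> y" "y < c' k"
proof -
  have "\<exists>!k. k \<in> S \<and> x \<in> {r k..<r' k} \<and> y \<in> {c k..<c' k}"
    using assms unfolding tiling_def by simp
  then show ?thesis using that by auto
qed

lemma tiling_disjoint:
  assumes T: "tiling S r r' c c' a b g h" and kl: "k \<in> S" "l \<in> S" "k \<noteq> l"
  shows "r' k \<le> r l \<or> r' l \<le> r k \<or> c' k \<le> c l \<or> c' l \<le> c k"
proof (rule ccontr)
  assume neg: "\<not> ?thesis"
  let ?x = "max (r k) (r l)" and ?y = "max (c k) (c l)"
  note k = tilingD[OF T kl(1)] and l = tilingD[OF T kl(2)]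
  have "?x \<in> {a..<b}" "?y \<in> {g..<h}" using k l by auto
  then have "\<exists>!k. k \<in> S \<and> ?x \<in> {r k..<r' k} \<and> ?y \<in> {c k..<c' k}"
    using T unfolding tiling_def by blast
  moreover have "?x \<in> {r k..<r' k}" "?x \<in> {r l..<r' l}" "?y \<in> {c k..<c' k}" "?y \<in> {c l..<c' l}"
    using neg k l by auto
  ultimately show False using kl by blast
qed

definition cut :: "'i set \<Rightarrow> ('i \<Rightarrow> nat) \<Rightarrow> ('i \<Rightarrow> nat) \<Rightarrow> nat \<Rightarrow> nat \<Rightarrow> nat \<Rightarrow> bool" where
  "cut S r r' a b x \<longleftrightarrow> a < x \<and> x < b \<and> (\<forall>k\<in>S. r' k \<le> x \<or> x \<le> r k)"

text \<open>Every other rectangle lies entirely above or entirely below the full-width one, so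
  both horizontal edges of that rectangle are cuts, except that one of them may be the border.\<close>

lemma full_width_cut:
  assumes T: "tiling S r r' c c' a b g h" and card: "2 \<le> card S"
    and k: "k \<in> S" "c k = g" "c' k = h"
  shows "\<exists>x. cut S r r' a b x"
proof -
  have "\<not> S \<subseteq> {k}" using card card_mono[of "{k}" S] by auto
  then obtain l where l: "l \<in> S" "l \<noteq> k" by blast
  have apart: "r' k \<le> r j \<or> r' j \<le> r k" if "j \<in> S" "j \<noteq> k" for j
    using tiling_disjoint[OF T k(1) that(1)] tilingD[OF T that(1)] k that(2) by auto
  note kD = tilingD[OF T k(1)] and lD = tilingD[OF T l(1)]
  show ?thesis
  proof (cases "a < r k")
    case True
    have "cut S r r' a b (r k)"
      unfolding cut_def using True kD apart by (metis le_refl less_le_trans order.strict_implies_order order_trans)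
    then show ?thesis by blast
  next
    case False
    have "r' j \<le> r' k \<or> r' k \<le> r j" if "j \<in> S" for j
      using apart[OF that] kD(1) by (cases "j = k") auto
    moreover have "r' k < b" using apart[OF l] False lD by linarith
    ultimately have "cut S r r' a b (r' k)" unfolding cut_def using kD by auto
    then show ?thesis by blast
  qed
qed

text \<open>The cell of the first row just right of \<open>p\<close> can only belong to \<open>q\<close>: the two top corner
  rectangles share the top side.\<close>

lemma top_seam:
  assumes T: "tiling S r r' c c' a b g h" and S: "S = {p, q, s, t}" and "p \<noteq> q"
    and p: "r p = a" "c p = g" "c' p < h" and q: "r q = a" "c' q = h"
    and st: "r s \<noteq> a" "r t \<noteq> a"
  shows "c' p = c q"
proof -
  note pD = tilingD[OF T, of p] and qD = tilingD[OF T, of q]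
  note sD = tilingD[OF T, of s] and tD = tilingD[OF T, of t]
  have "c' p \<le> c q"
    using tiling_disjoint[OF T, of p q] \<open>p \<noteq> q\<close> pD qD p q unfolding S by auto
  moreover obtain k where k: "k \<in> S" "r k \<le> a" "c k \<le> c' p" "c' p < c' k"
    using tiling_cover[OF T, of a "c' p"] pD p unfolding S by auto
  then have "k = q" using st sD tD pD unfolding S by auto
  then have "c q \<le> c' p" using k by simp
  ultimately show ?thesis by simp
qed

text \<open>Let \<open>p\<close>, \<open>q\<close>, \<open>s\<close>, \<open>t\<close> contain the top left, top right, bottom left and bottom right
  corner. If two of them coincide, that rectangle has full width or full height, which yields a
  cut. Otherwise they are all the rectangles and meet pairwise along the four sides, at the columns
  \<open>c' p = c q\<close> (top) and \<open>c' s = c t\<close> (bottom) and the rows \<open>r' p = r s\<close> (left) and \<open>r' q = r t\<close>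
  (right). If the two columns agree, or the two rows do, there is a cut. If neither, then in two of
  the four cases a diagonal pair of rectangles overlaps, and in the other two a cell in the middle
  stays uncovered.\<close>

lemma tiling_cut:
  assumes T: "tiling S r r' c c' a b g h" and card: "2 \<le> card S" "card S \<le> 4"
  shows "(\<exists>x. cut S r r' a b x) \<or> (\<exists>y. cut S c c' g h y)"
proof (rule ccontr)
  assume "\<not> ?thesis"
  then have norow: "\<not> cut S r r' a b x" and nocol: "\<not> cut S c c' g h x" for x by auto
  note T' = tiling_transpose[OF T]
  have fw: False if "k \<in> S" "c k = g" "c' k = h" for k
    using full_width_cut[OF T card(1) that] norow by blast
  have fh: False if "k \<in> S" "r k = a" "r' k = b" for k
    using full_width_cut[OF T' card(1) that] nocol by blast
  have fin: "finite S" using T unfolding tiling_def by simp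
  have "S \<noteq> {}" using card by auto
  then have ab: "a < b" "g < h" using tilingD[OF T] by (meson ex_in_conv le_less_trans less_le_trans)+
  have last: "a \<le> b - 1" "b - 1 < b" "g \<le> h - 1" "h - 1 < h" using ab by auto
  obtain p where p: "p \<in> S" "r p = a" "c p = g"
    using tiling_cover[OF T, of a g] ab tilingD[OF T] by (metis le_antisym order_refl)
  obtain q where q: "q \<in> S" "r q = a" "c' q = h"
  proof -
    obtain k where "k \<in> S" "r k \<le> a" "h - 1 < c' k"
      using tiling_cover[OF T order_refl ab(1) last(3,4)] by blast
    then show ?thesis using that[of k] tilingD[OF T, of k] by auto
  qed
  obtain s where s: "s \<in> S" "r' s = b" "c s = g"
  proof -
    obtain k where "k \<in> S" "c k \<le> g" "b - 1 < r' k"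
      using tiling_cover[OF T last(1,2) order_refl ab(2)] by blast
    then show ?thesis using that[of k] tilingD[OF T, of k] by auto
  qed
  obtain t where t: "t \<in> S" "r' t = b" "c' t = h"
  proof -
    obtain k where "k \<in> S" "h - 1 < c' k" "b - 1 < r' k"
      using tiling_cover[OF T last] by blast
    then show ?thesis using that[of k] tilingD[OF T, of k] by auto
  qed
  have dist: "p \<noteq> q" "p \<noteq> s" "p \<noteq> t" "q \<noteq> s" "q \<noteq> t" "s \<noteq> t"
    using p q s t fw fh by metis+
  then have "card {p, q, s, t} = 4" by simp
  then have S: "S = {p, q, s, t}"
    using card(2) card_subset_eq[OF fin, of "{p, q, s, t}"] card_mono[OF fin, of "{p, q, s, t}"] p q s t by auto
  have neq: "r' p \<noteq> b" "c' p \<noteq> h" "r' q \<noteq> b" "c q \<noteq> g" "r s \<noteq> a" "c' s \<noteq> h" "r t \<noteq> a" "c t \<noteq> g"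
    using p q s t fw fh by metis+
  note pD = tilingD[OF T p(1)] and qD = tilingD[OF T q(1)]
    and sD = tilingD[OF T s(1)] and tD = tilingD[OF T t(1)]
  have top: "c' p = c q"
    by (rule top_seam[OF T S dist(1) p(2,3) _ q(2,3) neq(5,7)]) (use neq pD in simp)
  have left: "r' p = r s"
    by (rule top_seam[OF T' _ dist(2) p(3,2) _ s(3,2) neq(4,8)]) (use neq pD S in auto)
  have bottom: "c' s = c t"
  proof (rule order_antisym)
    show "c' s \<le> c t" using tiling_disjoint[OF T s(1) t(1) dist(6)] s t sD tD by auto
    have "g \<le> c' s" "c' s < h" using sD neq(6) by auto
    then obtain k where k: "k \<in> S" "b - 1 < r' k" "c k \<le> c' s" "c' s < c' k"
      using tiling_cover[OF T last(1,2)] by blast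
    then have "k = t" using S neq pD qD by auto
    then show "c t \<le> c' s" using k by simp
  qed
  have right: "r' q = r t"
  proof (rule order_antisym)
    show "r' q \<le> r t" using tiling_disjoint[OF T q(1) t(1) dist(5)] q t qD tD by auto
    have "a \<le> r' q" "r' q < b" using qD neq(3) by auto
    then obtain k where k: "k \<in> S" "h - 1 < c' k" "r k \<le> r' q" "r' q < r' k"
      using tiling_cover[OF T _ _ last(3,4)] by blast
    then have "k = t" using S neq pD sD by auto
    then show "r t \<le> r' q" using k by simp
  qed
  have "c' p \<noteq> c' s"
    using nocol[of "c' p"] top bottom neq pD unfolding cut_def S by auto
  moreover have "r' p \<noteq> r' q"
    using norow[of "r' p"] left right neq pD unfolding cut_def S by auto
  (* The top right and the bottom left rectangle would overlap. *)
  moreover have "\<not> (c' p < c' s \<and> r' p < r' q)"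
    using tiling_disjoint[OF T q(1) s(1) dist(4)] q s qD sD top left by auto
  (* The top left and the bottom right rectangle would overlap. *)
  moreover have "\<not> (c' s < c' p \<and> r' q < r' p)"
    using tiling_disjoint[OF T p(1) t(1) dist(3)] p t pD tD bottom right by auto
  (* In the remaining two cases the seams leave a hole in the middle. *)
  moreover have "\<not> (c' p < c' s \<and> r' q < r' p)"
  proof
    assume lt: "c' p < c' s \<and> r' q < r' p"
    obtain k where "k \<in> S" "r k \<le> r' q" "r' q < r' k" "c k \<le> c' p" "c' p < c' k"
      using tiling_cover[OF T, of "r' q" "c' p"] pD qD neq by auto
    then show False using lt S top left bottom right by auto
  qed
  moreover have "\<not> (c' s < c' p \<and> r' p < r' q)"
  proof
    assume lt: "c' s < c' p \<and> r' p < r' q"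
    obtain k where "k \<in> S" "r k \<le> r' p" "r' p < r' k" "c k \<le> c' s" "c' s < c' k"
      using tiling_cover[OF T, of "r' p" "c' s"] pD sD neq by auto
    then show False using lt S top left bottom right by auto
  qed
  ultimately show False by linarith
qed

lemma tiling_cut_split:
  assumes T: "tiling S r r' c c' a b g h" and S: "S \<noteq> {}" and x: "cut S r r' a b x"
  defines "S1 \<equiv> {k \<in> S. r' k \<le> x}" and "S2 \<equiv> {k \<in> S. x \<le> r k}"
  shows "tiling S1 r r' c c' a x g h" "tiling S2 r r' c c' x b g h"
    "S = S1 \<union> S2" "S1 \<inter> S2 = {}" "S1 \<noteq> {}" "S2 \<noteq> {}" "finite S1" "finite S2"
proof -
  have fin: "finite S" using T unfolding tiling_def by simp
  note D = tilingD[OF T]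
  have ax: "a < x" "x < b" and side: "\<And>k. k \<in> S \<Longrightarrow> r' k \<le> x \<or> x \<le> r k"
    using x unfolding cut_def by auto
  show "finite S1" "finite S2" unfolding S1_def S2_def using fin by auto
  show "S = S1 \<union> S2" using side unfolding S1_def S2_def by auto
  show "S1 \<inter> S2 = {}" unfolding S1_def S2_def using D(1) by fastforce
  have gh: "g < h" using S D by (meson ex_in_conv le_less_trans less_le_trans)
  obtain k where "k \<in> S" "r k \<le> a" using tiling_cover[OF T, of a g] ax gh by auto
  then have "k \<in> S1" using side[of k] ax unfolding S1_def by auto
  then show "S1 \<noteq> {}" by blast
  obtain k where "k \<in> S" "x < r' k" using tiling_cover[OF T, of x g] ax gh by auto
  then have "k \<in> S2" using side[of k] unfolding S2_def by auto
  then show "S2 \<noteq> {}" by blast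
  have ex1: "\<exists>!k. k \<in> S \<and> z \<in> {r k..<r' k} \<and> y \<in> {c k..<c' k}"
    if "z \<in> {a..<b}" "y \<in> {g..<h}" for z y
    using T that unfolding tiling_def by blast
  have in1: "k \<in> S1 \<longleftrightarrow> k \<in> S" if "z \<in> {r k..<r' k}" "z < x" for k z
    using side[of k] that unfolding S1_def by auto
  have in2: "k \<in> S2 \<longleftrightarrow> k \<in> S" if "z \<in> {r k..<r' k}" "x \<le> z" for k z
    using side[of k] that unfolding S2_def by auto
  show "tiling S1 r r' c c' a x g h"
    unfolding tiling_def
  proof (intro conjI ballI)
    fix z y assume zy: "z \<in> {a..<x}" "y \<in> {g..<h}"
    have "(k \<in> S1 \<and> z \<in> {r k..<r' k} \<and> y \<in> {c k..<c' k})
        = (k \<in> S \<and> z \<in> {r k..<r' k} \<and> y \<in> {c k..<c' k})" for k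
      using in1[of z k] zy by auto
    moreover have "z \<in> {a..<b}" using zy ax by auto
    ultimately show "\<exists>!k. k \<in> S1 \<and> z \<in> {r k..<r' k} \<and> y \<in> {c k..<c' k}"
      using ex1[OF _ zy(2)] by presburger
  qed (use D fin in \<open>auto simp: S1_def\<close>)
  show "tiling S2 r r' c c' x b g h"
    unfolding tiling_def
  proof (intro conjI ballI)
    fix z y assume zy: "z \<in> {x..<b}" "y \<in> {g..<h}"
    have "(k \<in> S2 \<and> z \<in> {r k..<r' k} \<and> y \<in> {c k..<c' k})
        = (k \<in> S \<and> z \<in> {r k..<r' k} \<and> y \<in> {c k..<c' k})" for k
      using in2[of z k] zy by auto
    moreover have "z \<in> {a..<b}" using zy ax by auto
    ultimately show "\<exists>!k. k \<in> S2 \<and> z \<in> {r k..<r' k} \<and> y \<in> {c k..<c' k}"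
      using ex1[OF _ zy(2)] by presburger
  qed (use D fin in \<open>auto simp: S2_def\<close>)
qed

lemma tiling_singleton:
  assumes T: "tiling {k} r r' c c' a b g h"
  shows "r k = a" "r' k = b" "c k = g" "c' k = h"
proof -
  note D = tilingD[OF T, of k]
  have ab: "a < b" "g < h" using D by auto
  have last: "a \<le> b - 1" "b - 1 < b" "g \<le> h - 1" "h - 1 < h" using ab by auto
  have "r k \<le> a" "c k \<le> g" using tiling_cover[OF T order_refl ab(1) order_refl ab(2)] by blast+
  moreover have "b - 1 < r' k" "h - 1 < c' k" using tiling_cover[OF T last] by blast+
  ultimately show "r k = a" "r' k = b" "c k = g" "c' k = h" using D by auto
qed

section \<open>The bound for partitions\<close>

lemma tiling_abs_dominates:
  assumes "tiling S r r' c c' a b g h" "S \<noteq> {}" "card S \<le> 4"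
  shows "abs_dominates (block M a b g h) S (\<lambda>k. block M (r k) (r' k) (c k) (c' k))"
  using assms
proof (induction "card S" arbitrary: S a b g h rule: less_induct)
  case less
  note T = less.prems(1)
  let ?A = "\<lambda>k. block M (r k) (r' k) (c k) (c' k)"
  have fin: "finite S" using T unfolding tiling_def by simp
  have sub: "abs_dominates (block M a' b' g' h') S' ?A"
    if "tiling S' r r' c c' a' b' g' h'" "S' \<noteq> {}" "S' \<subset> S" for S' a' b' g' h'
    using less.hyps[of S'] that less.prems(3) psubset_card_mono[OF fin that(3)] by auto
  show ?case
  proof (cases "card S = 1")
    case True
    then obtain k where S: "S = {k}" by (auto simp: card_1_singleton_iff)
    have "?A k = block M a b g h" using tiling_singleton[OF T[unfolded S]] by simp
    then show ?thesis
      using abs_dominates_singleton[of "block M a b g h" k] unfolding S abs_dominates_def by simp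
  next
    case False
    then have "2 \<le> card S" using less.prems(2) fin
      by (metis One_nat_def Suc_1 Suc_leI card_gt_0_iff le_neq_implies_less)
    from tiling_cut[OF T this less.prems(3)] show ?thesis
    proof (elim disjE exE)
      fix x assume x: "cut S r r' a b x"
      note P = tiling_cut_split[OF T less.prems(2) x]
      let ?S1 = "{k \<in> S. r' k \<le> x}" and ?S2 = "{k \<in> S. x \<le> r k}"
      have "abs_splits (block M a b g h) (block M a x g h) (block M x b g h)"
        using x unfolding cut_def by (intro abs_splits_rows) auto
      then have "abs_dominates (block M a b g h) (?S1 \<union> ?S2) ?A"
        by (rule abs_dominates_union[OF _ sub[OF P(1)] sub[OF P(2)]]) (use P(3-8) in blast)+
      then show ?thesis using P(3) by simp
    next
      fix x assume x: "cut S c c' g h x"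
      note P = tiling_cut_split[OF tiling_transpose[OF T] less.prems(2) x]
      let ?S1 = "{k \<in> S. c' k \<le> x}" and ?S2 = "{k \<in> S. x \<le> c k}"
      have "abs_splits (block M a b g h) (block M a b g x) (block M a b x h)"
        using x unfolding cut_def by (intro abs_splits_columns) auto
      then have "abs_dominates (block M a b g h) (?S1 \<union> ?S2) ?A"
        by (rule abs_dominates_union[OF _ sub[OF tiling_transpose[OF P(1)]] sub[OF tiling_transpose[OF P(2)]]])
          (use P(3-8) in blast)+
      then show ?thesis using P(3) by simp
    qed
  qed
qed


text \<open>The isometries \<open>U k\<close> are those for the tiling by the four blocks; \<open>\<surd>4\<close> is the factor
  \<open>2\<close>. That a block has at most \<open>d'\<close> columns comes from its lying inside the matrix.\<close>

theorem corollary1p2: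
  fixes \<AA> A B C D :: "complex mat" and d d' :: nat
  assumes "\<AA> \<in> carrier_mat d d'"
    and "partitioned_into \<AA> [A, B, C, D]"
  shows "\<exists>U V W X.
    U \<in> carrier_mat d' (dim_col A) \<and> mat_isometry U \<and>
    V \<in> carrier_mat d' (dim_col B) \<and> mat_isometry V \<and>
    W \<in> carrier_mat d' (dim_col C) \<and> mat_isometry W \<and>
    X \<in> carrier_mat d' (dim_col D) \<and> mat_isometry X \<and>
    loewner_ge (2 \<cdot>\<^sub>m mat_abs \<AA>)
      (U * mat_abs A * mat_adjoint U + V * mat_abs B * mat_adjoint V
        + W * mat_abs C * mat_adjoint W + X * mat_abs D * mat_adjoint X)"
proof -
  let ?Bs = "[A, B, C, D]"
  have M: "\<AA> \<in> carrier_mat d d'" by (rule assms(1))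
  have len: "length ?Bs = 4" by simp
  obtain r r' c c' :: "nat \<Rightarrow> nat" where parts:
    "(\<forall>k<4. r k < r' k \<and> c k < c' k \<and> ?Bs ! k = submatrix \<AA> {r k..<r' k} {c k..<c' k}) \<and>
     (\<forall>k<4. \<forall>l<4. k \<noteq> l \<longrightarrow>
       ({r k..<r' k} \<times> {c k..<c' k}) \<inter> ({r l..<r' l} \<times> {c l..<c' l}) = {}) \<and>
     (\<Union>k<4. {r k..<r' k} \<times> {c k..<c' k}) = {..<d} \<times> {..<d'}"
    using assms(2) unfolding partitioned_into_def len carrier_matD[OF M] by (elim exE) (rule that)
  note blocks = parts[THEN conjunct1, rule_format]
    and disj = parts[THEN conjunct2, THEN conjunct1, rule_format]
    and cover = parts[THEN conjunct2, THEN conjunct2]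
  have bounds: "r' k \<le> d" "c' k \<le> d'" if k: "k < 4" for k
  proof -
    (* The last cell of a nonempty block lies in the matrix. *)
    have "(r' k - 1, c' k - 1) \<in> {r k..<r' k} \<times> {c k..<c' k}" using blocks[OF k] by auto
    then have "(r' k - 1, c' k - 1) \<in> {..<d} \<times> {..<d'}" using cover k by blast
    then show "r' k \<le> d" "c' k \<le> d'" by auto
  qed
  have T: "tiling {..<4} r r' c c' 0 d 0 d'"
    unfolding tiling_def
  proof (intro conjI ballI)
    fix x y assume xy: "x \<in> {0..<d}" "y \<in> {0..<d'}"
    then have "(x, y) \<in> (\<Union>k<4. {r k..<r' k} \<times> {c k..<c' k})" unfolding cover by simp
    then obtain k where k: "k < 4" "x \<in> {r k..<r' k}" "y \<in> {c k..<c' k}" by blast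
    show "\<exists>!k. k \<in> {..<4} \<and> x \<in> {r k..<r' k} \<and> y \<in> {c k..<c' k}"
      using k disj by (intro ex1I[of _ k]) blast+
  qed (use blocks bounds in auto)
  have nth: "?Bs ! k = block \<AA> (r k) (r' k) (c k) (c' k)" if "k < 4" for k
    using blocks[OF that] submatrix_eq_block bounds[OF that] M by simp
  have "{..<4 :: nat} \<noteq> {}" by (metis empty_iff lessThan_iff zero_less_numeral)
  then have "abs_dominates \<AA> {..<4} (\<lambda>k. block \<AA> (r k) (r' k) (c k) (c' k))"
    using tiling_abs_dominates[OF T, of \<AA>] block_whole[OF M] by simp
  then have "abs_dominates \<AA> {..<4} (\<lambda>k. ?Bs ! k)"
    unfolding abs_dominates_def using nth by simp
  then obtain U where U: "\<And>k. k < 4 \<Longrightarrow> U k \<in> carrier_mat d' (dim_col (?Bs ! k)) \<and>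
        mat_adjoint (U k) * U k = 1\<^sub>m (dim_col (?Bs ! k))"
    and le: "\<And>v. v \<in> carrier_vec d' \<Longrightarrow>
        (\<Sum>k<4. quad_form (U k * mat_abs (?Bs ! k) * mat_adjoint (U k)) v)
          \<le> sqrt 4 * quad_form (mat_abs \<AA>) v"
    using M unfolding abs_dominates_def by auto
  have iso: "mat_isometry (U k)" if "k < 4" for k
    using U[OF that] nth[OF that] bounds[OF that] unfolding mat_isometry_def by auto
  define Q where "Q k = U k * mat_abs (?Bs ! k) * mat_adjoint (U k)" for k
  have Q: "Q k \<in> carrier_mat d' d' \<and> mat_adjoint (Q k) = Q k" if k: "k < 4" for k
  proof -
    have abs: "mat_abs (?Bs ! k) \<in> carrier_mat (dim_col (?Bs ! k)) (dim_col (?Bs ! k))"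
      "psd_mat (mat_abs (?Bs ! k))"
      using mat_abs[of "?Bs ! k"] by blast+
    show ?thesis unfolding Q_def
      using adjoint_conj[OF abs(1) _ psd_matD(1)[OF abs(2,1)]] U[OF k] by auto
  qed
  define R where "R = Q 0 + Q 1 + Q 2 + Q 3"
  have R: "R \<in> carrier_mat d' d'" unfolding R_def using Q by auto
  have hR: "mat_adjoint R = R"
    unfolding R_def using Q by (simp add: adjoint_add[of _ d' d'])
  note absM = mat_abs[OF M]
  let ?P = "complex_of_real 2 \<cdot>\<^sub>m mat_abs \<AA>"
  have P: "?P \<in> carrier_mat d' d'" using absM by simp
  have hP: "mat_adjoint ?P = ?P"
    unfolding adjoint_smult_real psd_matD(1)[OF absM(2,1)] ..
  have "psd_mat (?P - R)"
  proof (rule psd_matI[OF minus_carrier_mat[OF R]])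
    show "mat_adjoint (?P - R) = ?P - R" unfolding adjoint_minus[OF P R] hP hR ..
    fix v :: "complex vec" assume v: "v \<in> carrier_vec d'"
    have "quad_form R v = (\<Sum>k<4. quad_form (Q k) v)"
      unfolding R_def using Q v by (simp add: quad_form_add[of _ d'] numeral_eq_Suc)
    also have "\<dots> \<le> quad_form ?P v"
      using le[OF v] unfolding Q_def quad_form_smult[OF absM(1) v] by simp
    finally show "0 \<le> quad_form (?P - R) v" using quad_form_minus[OF P R v] by simp
  qed
  then have "loewner_ge (2 \<cdot>\<^sub>m mat_abs \<AA>) (Q 0 + Q 1 + Q 2 + Q 3)"
    unfolding loewner_ge_def hermitian_mat_def R_def[symmetric]
    using hP hR carrier_matD(1)[OF P] carrier_matD(1)[OF R] by simp
  then show ?thesis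
    using U[of 0] U[of 1] U[of 2] U[of 3] iso[of 0] iso[of 1] iso[of 2] iso[of 3]
    unfolding Q_def by (intro exI[of _ "U 0"] exI[of _ "U 1"] exI[of _ "U 2"] exI[of _ "U 3"]) simp
qed

end
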